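(* Let $\Omega\subset\mathbb{R}^2$ be a bounded strictly convex domain with $C^2$ boundary of positive curvature, such that $\gamma=\partial\Omega$ is a centrally symmetric Radon curve. Then $$\beta^{\rm out}_\Omega\Big(\frac14\Big)\ \ge\ \frac{|\Omega|}{\pi}\,\beta^{\rm out}_{\mathcal D}\Big(\frac14\Big),$$ where $|\Omega|$ is the area of $\Omega$ and $\mathcal D$ is the unit disk, with equality if and only if $\Omega$ is an ellipse.
   Context: Radon curve: let $\gamma$ be a smooth closed convex curve in the plane, symmetric with respect to the origin. For $x,y\in\gamma$, $y$ is Birkhoff orthogonal to $x$ if the vector $y$ is parallel to the tangent line to $\gamma$ at $x$. The curve $\gamma$ is a Radon curve if this relation is symmetric. Outer billiard: for $p\in\mathbb{R}^2\setminus\overline\Omega$, consider the tangent line from $p$ to $\partial\Omega$ at a point $q$ such that the vector $\vec{pq}$ has the same orientation as $\partial\Omega$ at $q$; then $B^{\rm out}_\Omega(p)$ is the point on this line such that $q$ is the midpoint of $p$ and $B^{\rm out}_\Omega(p)$. It is an area-preserving positive twist map of the exterior of $\Omega$. $\beta^{\rm out}_\Omega$ denotes Mather's $\beta$-function (minimal average action) of $B^{\rm out}_\Omega$, where the action of a periodic orbit is the area of the corresponding circumscribed polygon. For coprime $p,q$ with $p/q\in(0,\frac12)$ one has $\beta^{\rm out}_\Omega(p/q)=\frac1q\,\mathcal A$, with $\mathcal A$ the minimal area of $q$-gons with winding number $p$ circumscribed about $\Omega$. In particular $\beta^{\rm out}_\Omega(1/4)=\frac14\min\{\text{area of quadrilaterals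 circumscribed about }\Omega\}$. For the unit disk, $\beta^{\rm out}_{\mathcal D}(\rho)=\tan(\pi\rho)$, so $\beta^{\rm out}_{\mathcal D}(1/4)=1$. *)

theory Defs
  imports "HOL-Analysis.Analysis"
begin

type_synonym plane = "real ^ 2"

definition cross2 :: "plane \<Rightarrow> plane \<Rightarrow> real" where
  "cross2 x y = x $ 1 * y $ 2 - x $ 2 * y $ 1"

text \<open>The signed angle from \<open>u\<close> to \<open>v\<close>, in \<open>(-\<pi>, \<pi>]\<close>.\<close>

definition signed_angle :: "plane \<Rightarrow> plane \<Rightarrow> real" where
  "signed_angle u v = Arg (Complex (u \<bullet> v) (cross2 u v))"


subsection \<open>Domains and their boundary curves\<close>

definition strictly_convex :: "plane set \<Rightarrow> bool" where
  "strictly_convex \<Omega> \<longleftrightarrow>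
     (\<forall>x\<in>closure \<Omega>. \<forall>y\<in>closure \<Omega>. x \<noteq> y \<longrightarrow> open_segment x y \<subseteq> interior \<Omega>)"

text \<open>
  A regular \<open>C\<^sup>2\<close> parametrization, with first and second derivative \<open>\<gamma>'\<close> and \<open>\<gamma>''\<close>, of the
  boundary as a simple closed curve of period \<open>T\<close>. On a simple closed curve, positivity of the
  \<^emph>\<open>signed\<close> curvature says that the curvature is positive and that the parametrization is
  counterclockwise, so that this also fixes the orientation of the boundary.
\<close>

definition C2_boundary_param ::
    "plane set \<Rightarrow> (real \<Rightarrow> plane) \<Rightarrow> (real \<Rightarrow> plane) \<Rightarrow> (real \<Rightarrow> plane) \<Rightarrow> real \<Rightarrow> bool" where
  "C2_boundary_param \<Omega> \<gamma> \<gamma>' \<gamma>'' T \<longleftrightarrow>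
     T > 0 \<and> (\<forall>t. \<gamma> (t + T) = \<gamma> t) \<and> inj_on \<gamma> {0..<T} \<and> \<gamma> ` {0..<T} = frontier \<Omega> \<and>
     (\<forall>t. (\<gamma> has_vector_derivative \<gamma>' t) (at t)) \<and>
     (\<forall>t. (\<gamma>' has_vector_derivative \<gamma>'' t) (at t)) \<and>
     continuous_on UNIV \<gamma>'' \<and>
     (\<forall>t. \<gamma>' t \<noteq> 0) \<and>
     (\<forall>t. cross2 (\<gamma>' t) (\<gamma>'' t) / norm (\<gamma>' t) ^ 3 > 0)"

definition C2_convex_domain :: "plane set \<Rightarrow> bool" where
  "C2_convex_domain \<Omega> \<longleftrightarrow>
     open \<Omega> \<and> connected \<Omega> \<and> \<Omega> \<noteq> {} \<and> bounded \<Omega> \<and> strictly_convex \<Omega> \<and>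
     (\<exists>\<gamma> \<gamma>' \<gamma>'' T. C2_boundary_param \<Omega> \<gamma> \<gamma>' \<gamma>'' T)"

definition tangent_at :: "plane set \<Rightarrow> plane \<Rightarrow> plane \<Rightarrow> bool" where
  "tangent_at \<Omega> x v \<longleftrightarrow>
     (\<exists>\<gamma> \<gamma>' \<gamma>'' T t k. C2_boundary_param \<Omega> \<gamma> \<gamma>' \<gamma>'' T \<and> \<gamma> t = x \<and> v = k *\<^sub>R \<gamma>' t)"

definition positively_tangent_at :: "plane set \<Rightarrow> plane \<Rightarrow> plane \<Rightarrow> bool" where
  "positively_tangent_at \<Omega> x v \<longleftrightarrow>
     (\<exists>\<gamma> \<gamma>' \<gamma>'' T t k. C2_boundary_param \<Omega> \<gamma> \<gamma>' \<gamma>'' T \<and> \<gamma> t = x \<and> k > 0 \<and> v = k *\<^sub>R \<gamma>' t)"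


subsection \<open>Radon curves\<close>

text \<open>\<open>birkhoff_orthogonal \<Omega> x y\<close>: the vector \<open>y\<close> is Birkhoff orthogonal to \<open>x\<close>.\<close>

definition birkhoff_orthogonal :: "plane set \<Rightarrow> plane \<Rightarrow> plane \<Rightarrow> bool" where
  "birkhoff_orthogonal \<Omega> x y \<longleftrightarrow> tangent_at \<Omega> x y"

definition radon_boundary :: "plane set \<Rightarrow> bool" where
  "radon_boundary \<Omega> \<longleftrightarrow>
     (\<forall>x\<in>frontier \<Omega>. - x \<in> frontier \<Omega>) \<and>
     (\<forall>x\<in>frontier \<Omega>. \<forall>y\<in>frontier \<Omega>. birkhoff_orthogonal \<Omega> x y \<longrightarrow> birkhoff_orthogonal \<Omega> y x)"


subsection \<open>Outer billiards and Mather's beta function\<close>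

definition tangency_point :: "plane set \<Rightarrow> plane \<Rightarrow> plane" where
  "tangency_point \<Omega> p = (THE q. q \<in> frontier \<Omega> \<and> positively_tangent_at \<Omega> q (q - p))"

text \<open>The tangency point is the midpoint of \<open>p\<close> and its image.\<close>

definition outer_billiard :: "plane set \<Rightarrow> plane \<Rightarrow> plane" where
  "outer_billiard \<Omega> p = 2 *\<^sub>R tangency_point \<Omega> p - p"

definition outer_orbit :: "plane set \<Rightarrow> (nat \<Rightarrow> plane) \<Rightarrow> bool" where
  "outer_orbit \<Omega> p \<longleftrightarrow> p 0 \<notin> closure \<Omega> \<and> (\<forall>n. p (Suc n) = outer_billiard \<Omega> (p n))"

text \<open>
  The angular coordinate of a point \<open>p n\<close> of the exterior is the direction of the oriented tangent
  line through it, that is, of the edge from \<open>p n\<close> to \<open>p (Suc n)\<close>. The rotation number is the mean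
  number of turns of this direction per step: a closed orbit with \<open>q\<close> vertices and winding number
  \<open>w\<close> about the domain has rotation number \<open>w / q\<close>.
\<close>

definition has_rotation_number :: "(nat \<Rightarrow> plane) \<Rightarrow> real \<Rightarrow> bool" where
  "has_rotation_number p \<rho> \<longleftrightarrow>
     (\<lambda>N. (\<Sum>n<N. signed_angle (p (Suc n) - p n) (p (Suc (Suc n)) - p (Suc n))) / (2 * pi) / real N)
       \<longlonglongrightarrow> \<rho>"

text \<open>
  The action of one step is the shoelace term. Its sum over one period of a periodic orbit is the
  area (counted with winding) of the polygon with vertices \<open>p 0, p 1, \<dots>\<close>, which is
  circumscribed about the domain.
\<close>

definition outer_action :: "plane \<Rightarrow> plane \<Rightarrow> real" where
  "outer_action x y = cross2 x y / 2"

definition has_mean_action :: "(nat \<Rightarrow> plane) \<Rightarrow> real \<Rightarrow> bool" where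
  "has_mean_action p a \<longleftrightarrow>
     (\<lambda>N. (\<Sum>n<N. outer_action (p n) (p (Suc n))) / real N) \<longlonglongrightarrow> a"

text \<open>
  The minimal average action over all orbits with rotation number \<open>\<rho>\<close>. It is meaningful for
  \<open>0 < \<rho> < 1/2\<close>.
\<close>

definition beta_out :: "plane set \<Rightarrow> real \<Rightarrow> real" where
  "beta_out \<Omega> \<rho> =
     Inf {a. \<exists>p. outer_orbit \<Omega> p \<and> has_rotation_number p \<rho> \<and> has_mean_action p a}"


subsection \<open>Ellipses\<close>

text \<open>The open region bounded by an ellipse with centre \<open>c\<close>, orthonormal axes \<open>u, v\<close> and semi-axes
  \<open>a, b\<close>.\<close>

definition is_ellipse :: "plane set \<Rightarrow> bool" where
  "is_ellipse \<Omega> \<longleftrightarrow>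
     (\<exists>c u v a b. norm u = 1 \<and> norm v = 1 \<and> u \<bullet> v = 0 \<and> a > 0 \<and> b > 0 \<and>
        \<Omega> = {x. (((x - c) \<bullet> u) / a)\<^sup>2 + (((x - c) \<bullet> v) / b)\<^sup>2 < 1})"

end

theory Submission
  imports Defs
begin

text \<open>
  Write \<open>c\<close> for the value of the area form \<open>cross2 x y\<close> on a conjugate pair, that is, on boundary
  points \<open>x\<close>, \<open>y\<close> such that \<open>y\<close> is positively tangent at \<open>x\<close>. The Radon property makes the
  conjugate of \<open>y\<close> equal to \<open>- x\<close>, so that moving a pair moves each vector along the other one and
  \<open>c\<close> does not depend on the pair (\<open>conj_cross2_const\<close>). It follows that \<open>c\<close> bounds the area form on
  the whole domain (\<open>abs_cross2_le_conj\<close>). The theorem splits into \<open>\<beta>(1/4) = c\<close> and the isoperimetric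
  statement \<open>|\<Omega>| \<le> \<pi> c\<close> with equality for ellipses only.

  \<^emph>\<open>The beta function.\<close> Every exterior point is \<open>x - s y\<close> with \<open>(x, y)\<close> conjugate and \<open>s > 0\<close>; its
  image is \<open>x + s y\<close>, and the action of the step is \<open>c s\<close>. The points with \<open>s = 1\<close> form an invariant
  curve of orbits of period 4, whose mean action is \<open>c\<close>. No orbit of rotation number \<open>1/4\<close> does
  better. Outside the invariant curve every step has action at least \<open>c\<close>. On it and inside
  it, the deficit of the turning angle of a step against a quarter turn bounds a multiple of \<open>1 - s\<close>,
  up to a telescoping term (\<open>step_length_ge_turning\<close>). The mean deficit vanishes when the rotation
  number is \<open>1/4\<close>, so the mean of \<open>s\<close> is at least 1 (\<open>mean_action_ge\<close>). The unit
  disk is itself a Radon domain, with \<open>c = 1\<close>.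

  \<^emph>\<open>The area.\<close> In the oblique coordinates of a conjugate pair, the domain becomes a plane convex set
  \<open>K\<close> between the abscissas \<open>-1\<close> and 1 on which the area form is bounded by 1. If \<open>f\<close> is the height of
  the upper boundary of \<open>K\<close>, the boundary points over \<open>- cos t\<close> and \<open>sin t\<close> satisfy
  \<open>sin t f(- cos t) + cos t f(sin t) \<le> 1\<close>, and likewise below the axis. Integrated over the quarter
  turn, the left-hand sides add up to the area of \<open>K\<close>, which is therefore at most \<open>\<pi>\<close> (\<open>area_le_pi\<close>).
  This is the argument of Sas for inscribed polygons. Equality of areas forces equality for
  every \<open>t\<close>, and then \<open>quarter_circle_rigidity\<close> identifies \<open>f\<close> with a semicircle. So \<open>K\<close> is the unit
  disk and the domain is an ellipse.
\<close>

section \<open>The area form on the plane\<close>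

lemma vec2_eq_iff: "(x::plane) = y \<longleftrightarrow> x $ 1 = y $ 1 \<and> x $ 2 = y $ 2"
  by (simp add: vec_eq_iff forall_2)

lemma inner2: "(x::plane) \<bullet> y = x $ 1 * y $ 1 + x $ 2 * y $ 2"
  by (simp add: inner_vec_def sum_2)

text \<open>The quarter turn; it turns the area form into the inner product.\<close>
definition rot :: "plane \<Rightarrow> plane" where
  "rot v = vector [- v $ 2, v $ 1]"

lemma rot_nth [simp]: "rot v $ 1 = - v $ 2" "rot v $ 2 = v $ 1"
  by (simp_all add: rot_def)

lemma cross2_eq_inner: "cross2 v w = rot v \<bullet> w"
  by (simp add: cross2_def inner2)

lemma bounded_linear_cross2: "bounded_linear (cross2 v)"
  unfolding cross2_eq_inner[abs_def] by (rule bounded_linear_inner_right)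

lemma continuous_on_cross2 [continuous_intros]:
  assumes "continuous_on S f" "continuous_on S g"
  shows "continuous_on S (\<lambda>x. cross2 (f x) (g x))"
  unfolding cross2_def by (intro continuous_intros assms)

lemma cross2_simps [simp]:
  "cross2 v 0 = 0" "cross2 0 v = 0" "cross2 v v = 0"
  "cross2 v (- w) = - cross2 v w" "cross2 (- v) w = - cross2 v w"
  "cross2 v (k *\<^sub>R w) = k * cross2 v w" "cross2 (k *\<^sub>R v) w = k * cross2 v w"
  by (simp_all add: cross2_def algebra_simps)

lemma cross2_add:
  "cross2 v (w + z) = cross2 v w + cross2 v z" "cross2 (v + w) z = cross2 v z + cross2 w z"
  "cross2 v (w - z) = cross2 v w - cross2 v z" "cross2 (v - w) z = cross2 v z - cross2 w z"
  by (simp_all add: cross2_def algebra_simps)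

lemma cross2_skew: "cross2 v w = - cross2 w v"
  by (simp add: cross2_def)

lemma cross2_rot: "cross2 v (rot v) = (norm v)\<^sup>2"
  by (simp add: cross2_def power2_norm_eq_inner inner2)

lemma cross2_cramer: "cross2 x y *\<^sub>R z = cross2 z y *\<^sub>R x + cross2 x z *\<^sub>R y"
  by (simp add: vec2_eq_iff cross2_def algebra_simps)

lemma cross2_pluecker:
  "cross2 x y * cross2 u v = cross2 u y * cross2 x v + cross2 x u * cross2 y v"
  by (simp add: cross2_def algebra_simps)

lemma lagrange_cross2: "(u \<bullet> v)\<^sup>2 + (cross2 u v)\<^sup>2 = (norm u)\<^sup>2 * (norm v)\<^sup>2"
  by (simp only: cross2_def inner2 power2_norm_eq_inner) (simp add: power2_eq_square algebra_simps)

lemma abs_cross2_le: "\<bar>cross2 u v\<bar> \<le> norm u * norm v"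
proof -
  have "(cross2 u v)\<^sup>2 \<le> (norm u * norm v)\<^sup>2"
    unfolding power_mult_distrib lagrange_cross2[of u v, symmetric] by simp
  then show ?thesis by (simp add: abs_le_square_iff[symmetric])
qed

lemma parallel_if_cross2_eq_0:
  assumes "cross2 v w = 0" "v \<noteq> 0"
  obtains k where "w = k *\<^sub>R v"
proof -
  have "cross2 (rot v) v *\<^sub>R w = cross2 (rot v) w *\<^sub>R v"
    using cross2_cramer[of "rot v" v w] cross2_skew[of v w] assms by simp
  moreover have "cross2 (rot v) v \<noteq> 0"
    using cross2_rot[of v] cross2_skew[of "rot v" v] assms by (simp del: cross2_simps(3))
  ultimately have "w = (cross2 (rot v) w / cross2 (rot v) v) *\<^sub>R v"
    by (simp add: vec2_eq_iff field_simps)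
  then show ?thesis using that by blast
qed

section \<open>Supporting directions of a strictly convex domain\<close>

text \<open>The directed line through \<open>q\<close> along \<open>v\<close> supports the domain and leaves it on its left. For a
  \<open>C\<^sup>2\<close> domain this is positive tangency, stated without reference to a parametrization.\<close>
definition supports :: "plane set \<Rightarrow> plane \<Rightarrow> plane \<Rightarrow> bool" where
  "supports \<Omega> q v \<longleftrightarrow> q \<in> frontier \<Omega> \<and> v \<noteq> 0 \<and> (\<forall>z\<in>closure \<Omega>. cross2 v (z - q) \<ge> 0)"

lemma second_derivative_le_0_at_max:
  fixes f :: "real \<Rightarrow> real"
  assumes f: "\<And>s. (f has_real_derivative f' s) (at s)"
    and f': "(f' has_real_derivative d) (at t)"
    and max: "\<And>s. f s \<le> f t"
  shows "f' t = 0" "d \<le> 0"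
proof -
  show 0: "f' t = 0"
    using DERIV_local_max[OF f, of 1 t] max by auto
  show "d \<le> 0"
  proof (rule ccontr)
    assume "\<not> d \<le> 0"
    then obtain e where e: "e > 0" "\<And>h. 0 < h \<Longrightarrow> h < e \<Longrightarrow> f' t < f' (t + h)"
      using DERIV_pos_inc_right[OF f'] by force
    obtain z where z: "z > t" "z < t + e/2" "f (t + e/2) - f t = (t + e/2 - t) * f' z"
      using MVT2[of t "t + e/2" f f'] f e(1) by auto
    have "f' z > 0" using e(2)[of "z - t"] z e(1) 0 by auto
    then have "(t + e/2 - t) * f' z > 0" using e(1) by simp
    then show False using max[of "t + e/2"] z by linarith
  qed
qed

locale strictly_convex_domain =
  fixes \<Omega> :: "plane set"
  assumes opn: "open \<Omega>" and ne: "\<Omega> \<noteq> {}" and bdd: "bounded \<Omega>" and sc: "strictly_convex \<Omega>"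
begin

lemma open_segment_subset: "x \<in> closure \<Omega> \<Longrightarrow> y \<in> closure \<Omega> \<Longrightarrow> x \<noteq> y \<Longrightarrow> open_segment x y \<subseteq> \<Omega>"
  using sc opn by (auto simp: strictly_convex_def interior_open)

lemma conv: "convex \<Omega>"
  unfolding convex_contains_open_segment
  using open_segment_subset closure_subset by (metis empty_subsetI open_segment_idem subsetD)

lemma frontier_eq: "frontier \<Omega> = closure \<Omega> - \<Omega>"
  using opn by (simp add: frontier_def interior_open)

lemma compact_closure: "compact (closure \<Omega>)"
  using bdd by simp

text \<open>A supporting line does not meet the open domain: from a common point, a small step against the
  normal would cross the line.\<close>
lemma supports_strict:
  assumes "v \<noteq> 0" "\<And>z. z \<in> \<Omega> \<Longrightarrow> cross2 v (z - q) \<ge> 0" "z \<in> \<Omega>"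
  shows "cross2 v (z - q) > 0"
proof -
  obtain e where e: "e > 0" "ball z e \<subseteq> \<Omega>"
    using opn assms(3) openE by blast
  define d where "d = e / (2 * norm v)"
  have d: "d > 0" using e assms(1) by (simp add: d_def)
  have nrot: "norm (rot v) = norm v"
    by (simp add: norm_eq_sqrt_inner inner2 algebra_simps)
  have "z - d *\<^sub>R rot v \<in> ball z e"
    using e assms(1) by (simp add: dist_norm nrot d_def)
  then have "cross2 v (z - d *\<^sub>R rot v - q) \<ge> 0" using e assms by blast
  then have "cross2 v (z - q) \<ge> d * (norm v)\<^sup>2"
    by (simp add: cross2_add cross2_rot)
  moreover have "d * (norm v)\<^sup>2 > 0" using d assms by simp
  ultimately show ?thesis by linarith
qed

lemma supportsI:
  assumes "q \<in> frontier \<Omega>" "v \<noteq> 0" "\<And>z. z \<in> \<Omega> \<Longrightarrow> cross2 v (z - q) \<ge> 0"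
  shows "supports \<Omega> q v"
proof -
  have "closure \<Omega> \<subseteq> {z. cross2 v (z - q) \<ge> 0}"
    by (rule closure_minimal) (use assms in \<open>auto intro!: closed_Collect_le continuous_intros\<close>)
  then show ?thesis using assms by (auto simp: supports_def)
qed

lemma supports_pos:
  assumes "supports \<Omega> q v" "z \<in> \<Omega>"
  shows "cross2 v (z - q) > 0"
  using assms supports_strict[of v q z] closure_subset[of \<Omega>] unfolding supports_def by blast

text \<open>By strict convexity a supporting line has only one point of contact: the midpoint between two
  of them would be an interior point on the line.\<close>
lemma supports_pos_closure:
  assumes "supports \<Omega> q v" "z \<in> closure \<Omega>" "z \<noteq> q"
  shows "cross2 v (z - q) > 0"
proof -
  define m where "m = (1/2) *\<^sub>R q + (1/2) *\<^sub>R z"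
  have q: "q \<in> closure \<Omega>" using assms by (auto simp: supports_def frontier_eq)
  have "m \<in> open_segment q z"
    using assms(3) by (auto simp: m_def in_segment intro!: exI[of _ "1/2"])
  then have "m \<in> \<Omega>" using open_segment_subset[OF q assms(2)] assms(3) by auto
  from supports_pos[OF assms(1) this] show ?thesis
    by (simp add: m_def cross2_add field_simps)
qed

lemma ex_supports:
  assumes "q \<in> frontier \<Omega>"
  obtains v where "supports \<Omega> q v"
proof -
  have "q \<notin> \<Omega>" using assms frontier_eq by auto
  then obtain a b where ab: "a \<noteq> 0" "a \<bullet> q \<le> b" "\<And>z. z \<in> \<Omega> \<Longrightarrow> a \<bullet> z \<ge> b"
    using separating_hyperplane_sets[of "{q}" \<Omega>] conv ne by auto
  have c: "cross2 (- rot a) w = a \<bullet> w" for w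
    by (simp add: cross2_def inner2)
  have "supports \<Omega> q (- rot a)"
  proof (rule supportsI[OF assms])
    show "- rot a \<noteq> 0" using ab(1) by (auto simp: vec2_eq_iff)
    show "cross2 (- rot a) (z - q) \<ge> 0" if "z \<in> \<Omega>" for z
      unfolding c using ab(2) ab(3)[OF that] by (simp add: inner_diff_right)
  qed
  then show ?thesis using that by blast
qed

text \<open>The tangency point seen from an exterior point exists because the directions to the compact
  closure of the domain, which lie in an open half-plane, have a rightmost one.\<close>
lemma ex1_supports_from:
  assumes "p \<notin> closure \<Omega>"
  shows "\<exists>!q. supports \<Omega> q (q - p)"
proof -
  \<comment> \<open>Seen from \<open>p\<close>, the slope over the axis \<open>e\<close> is smallest at the rightmost point.\<close>
  obtain e b where e: "e \<bullet> p < b" "\<And>z. z \<in> closure \<Omega> \<Longrightarrow> e \<bullet> z > b"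
    using separating_hyperplane_closed_point[OF convex_closure[OF conv] closed_closure assms] by auto
  have pos: "e \<bullet> (z - p) > 0" if "z \<in> closure \<Omega>" for z
    using e(1) e(2)[OF that] by (simp add: inner_diff_right)
  have "continuous_on (closure \<Omega>) (\<lambda>z. cross2 e (z - p) / (e \<bullet> (z - p)))"
    using pos by (intro continuous_intros ballI notI) fastforce
  then obtain q where q: "q \<in> closure \<Omega>"
    and min: "\<And>z. z \<in> closure \<Omega> \<Longrightarrow>
      cross2 e (q - p) / (e \<bullet> (q - p)) \<le> cross2 e (z - p) / (e \<bullet> (z - p))"
    using continuous_attains_inf[OF compact_closure, of "\<lambda>z. cross2 e (z - p) / (e \<bullet> (z - p))"] ne
    by auto
  have qp: "q \<noteq> p" using q assms by auto
  have "e \<noteq> 0" using pos[OF q] by auto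
  then have ee: "e \<bullet> e > 0" by simp
  have c0: "cross2 (q - p) (z - q) \<ge> 0" if "z \<in> closure \<Omega>" for z
  proof -
    have "cross2 e (q - p) * (e \<bullet> (z - p)) \<le> cross2 e (z - p) * (e \<bullet> (q - p))"
      using min[OF that] pos[OF that] pos[OF q] by (simp add: field_simps)
    moreover have "cross2 e (z - p) * (e \<bullet> (q - p)) - cross2 e (q - p) * (e \<bullet> (z - p))
        = (e \<bullet> e) * cross2 (q - p) (z - p)"
      by (simp add: cross2_def inner2 algebra_simps)
    ultimately have "(e \<bullet> e) * cross2 (q - p) (z - p) \<ge> 0" by linarith
    then have "cross2 (q - p) (z - p) \<ge> 0" using ee by (simp add: zero_le_mult_iff)
    moreover have "cross2 (q - p) (z - q) = cross2 (q - p) (z - p)"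
      by (simp add: cross2_def algebra_simps)
    ultimately show ?thesis by simp
  qed
  have "q \<notin> \<Omega>"
    using supports_strict[of "q - p" q q] c0 closure_subset[of \<Omega>] qp by force
  then have "supports \<Omega> q (q - p)"
    using q c0 qp by (auto simp: supports_def frontier_eq)
  moreover have "q1 = q2" if s1: "supports \<Omega> q1 (q1 - p)" and s2: "supports \<Omega> q2 (q2 - p)" for q1 q2
  proof (rule ccontr)
    assume ne12: "q1 \<noteq> q2"
    have m: "q1 \<in> closure \<Omega>" "q2 \<in> closure \<Omega>"
      using s1 s2 by (auto simp: supports_def frontier_eq)
    from supports_pos_closure[OF s1 m(2)] supports_pos_closure[OF s2 m(1)] ne12
    show False by (simp add: cross2_def algebra_simps)
  qed
  ultimately show ?thesis by blast
qed

end

section \<open>Tangent vectors as supporting directions\<close>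

text \<open>A function with increments of second order has derivative zero. This replaces a
  differentiation wherever only one-sided maximality estimates are at hand.\<close>
lemma constant_if_quadratic_variation:
  fixes f :: "real \<Rightarrow> real"
  assumes "convex S" "\<And>s t. s \<in> S \<Longrightarrow> t \<in> S \<Longrightarrow> \<bar>f s - f t\<bar> \<le> M * (s - t)\<^sup>2"
  obtains c where "\<And>s. s \<in> S \<Longrightarrow> f s = c"
proof -
  have "(f has_field_derivative 0) (at x within S)" if x: "x \<in> S" for x
  proof -
    have "((\<lambda>y. (f y - f x) / (y - x)) \<longlongrightarrow> 0) (at x within S)"
    proof (rule Lim_null_comparison)
      show "\<forall>\<^sub>F y in at x within S. norm ((f y - f x) / (y - x)) \<le> M * \<bar>y - x\<bar>"
      proof (rule eventually_at_topological[THEN iffD2], intro exI[of _ UNIV] conjI ballI impI)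
        fix y assume y: "y \<noteq> x" "y \<in> S"
        have "\<bar>f y - f x\<bar> \<le> M * \<bar>y - x\<bar> * \<bar>y - x\<bar>"
          using assms(2)[OF y(2) x] by (simp add: power2_eq_square mult.assoc flip: abs_mult)
        then show "norm ((f y - f x) / (y - x)) \<le> M * \<bar>y - x\<bar>"
          using y by (simp add: divide_simps)
      qed auto
      show "((\<lambda>y. M * \<bar>y - x\<bar>) \<longlongrightarrow> 0) (at x within S)"
        by (auto intro!: tendsto_eq_intros)
    qed
    then show ?thesis by (simp add: has_field_derivative_iff)
  qed
  then show ?thesis
    using has_field_derivative_zero_constant[OF assms(1), of f] that by blast
qed

lemma C2_boundary_param_in_frontier:
  assumes "C2_boundary_param \<Omega> \<gamma> \<gamma>' \<gamma>'' T"
  shows "\<gamma> t \<in> frontier \<Omega>"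
proof -
  have T: "T > 0" and per: "\<And>t. \<gamma> (t + T) = \<gamma> t" and im: "\<gamma> ` {0..<T} = frontier \<Omega>"
    using assms by (auto simp: C2_boundary_param_def)
  interpret periodic_fun_simple \<gamma> T by standard (rule per)
  define k where "k = \<lfloor>t / T\<rfloor>"
  have "of_int k \<le> t / T" "t / T < of_int k + 1" by (auto simp: k_def)
  then have "t - of_int k * T \<in> {0..<T}" using T by (auto simp: field_simps)
  then have "\<gamma> (t - of_int k * T) \<in> frontier \<Omega>" using im by blast
  then show ?thesis by (simp add: minus_of_int)
qed

lemma has_derivative_cross2_curve:
  assumes "(\<gamma> has_vector_derivative d) (at t)"
  shows "((\<lambda>s. cross2 v (\<gamma> s)) has_real_derivative cross2 v d) (at t)"
  using bounded_linear.has_vector_derivative[OF bounded_linear_cross2 assms, of v]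
  by (simp add: has_real_derivative_iff_has_vector_derivative)

lemma supports_scaleR: "k > 0 \<Longrightarrow> supports \<Omega> q (k *\<^sub>R v) \<longleftrightarrow> supports \<Omega> q v"
  by (auto simp: supports_def zero_le_mult_iff)

context strictly_convex_domain
begin

text \<open>The linear functional of a supporting line is extremal along the boundary curve at the contact
  point. The first-order condition makes the velocity parallel to the line, and the second-order
  condition together with positive curvature fixes its orientation.\<close>
lemma supports_velocity:
  assumes "C2_boundary_param \<Omega> \<gamma> \<gamma>' \<gamma>'' T"
  shows "supports \<Omega> (\<gamma> t) (\<gamma>' t)"
    and "supports \<Omega> (\<gamma> t) v \<Longrightarrow> \<exists>k>0. v = k *\<^sub>R \<gamma>' t"
proof -
  have d1: "\<And>t. (\<gamma> has_vector_derivative \<gamma>' t) (at t)"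
    and d2: "\<And>t. (\<gamma>' has_vector_derivative \<gamma>'' t) (at t)"
    and n0: "\<gamma>' t \<noteq> 0"
    and curv: "cross2 (\<gamma>' t) (\<gamma>'' t) > 0"
    using assms by (auto simp: C2_boundary_param_def zero_less_divide_iff)
  have fr: "\<gamma> s \<in> frontier \<Omega>" for s
    using C2_boundary_param_in_frontier[OF assms] .
  have *: "\<exists>k>0. v = k *\<^sub>R \<gamma>' t" if v: "supports \<Omega> (\<gamma> t) v" for v
  proof -
    let ?f = "\<lambda>s. cross2 (- v) (\<gamma> s)"
    have max: "?f s \<le> ?f t" for s
      using v fr[of s] by (simp add: supports_def frontier_eq cross2_add)
    have 1: "cross2 (- v) (\<gamma>' t) = 0" and 2: "cross2 (- v) (\<gamma>'' t) \<le> 0"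
      using second_derivative_le_0_at_max[of ?f "\<lambda>s. cross2 (- v) (\<gamma>' s)" "cross2 (- v) (\<gamma>'' t)" t]
        has_derivative_cross2_curve[OF d1] has_derivative_cross2_curve[OF d2] max by blast+
    have "cross2 (\<gamma>' t) v = 0" using 1 cross2_skew[of "\<gamma>' t" v] by simp
    then obtain k where k: "v = k *\<^sub>R \<gamma>' t"
      using parallel_if_cross2_eq_0 n0 by blast
    have "k * cross2 (\<gamma>' t) (\<gamma>'' t) \<ge> 0" using 2 k by simp
    then have "k \<ge> 0" using curv by (simp add: zero_le_mult_iff)
    moreover have "k \<noteq> 0" using v k by (auto simp: supports_def)
    ultimately show ?thesis using k by (intro exI[of _ k]) simp
  qed
  then show "supports \<Omega> (\<gamma> t) v \<Longrightarrow> \<exists>k>0. v = k *\<^sub>R \<gamma>' t" .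
  obtain v where v: "supports \<Omega> (\<gamma> t) v" using ex_supports[OF fr] by blast
  from *[OF this] obtain k where k: "k > 0" "v = k *\<^sub>R \<gamma>' t" by blast
  show "supports \<Omega> (\<gamma> t) (\<gamma>' t)"
    using v supports_scaleR[of k] unfolding k(2) using k(1) by blast
qed

end

locale C2_domain =
  fixes \<Omega> :: "plane set"
  assumes dom: "C2_convex_domain \<Omega>"
begin

sublocale strictly_convex_domain
  using dom by unfold_locales (auto simp: C2_convex_domain_def)

lemma positively_tangent_iff_supports: "positively_tangent_at \<Omega> x v \<longleftrightarrow> supports \<Omega> x v"
proof
  assume "positively_tangent_at \<Omega> x v"
  then show "supports \<Omega> x v"
    using supports_velocity(1) by (auto simp: positively_tangent_at_def supports_scaleR)
next
  assume s: "supports \<Omega> x v"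
  obtain \<gamma> \<gamma>' \<gamma>'' T where p: "C2_boundary_param \<Omega> \<gamma> \<gamma>' \<gamma>'' T"
    using dom by (auto simp: C2_convex_domain_def)
  then obtain t where t: "x = \<gamma> t"
    using s unfolding C2_boundary_param_def supports_def by blast
  from supports_velocity(2)[OF p s[unfolded t]] obtain k where "k > 0" "v = k *\<^sub>R \<gamma>' t" by blast
  then show "positively_tangent_at \<Omega> x v"
    using p t unfolding positively_tangent_at_def by blast
qed

lemma supports_imp_tangent: "supports \<Omega> x v \<Longrightarrow> tangent_at \<Omega> x v"
  unfolding positively_tangent_iff_supports[symmetric]
  by (auto simp: positively_tangent_at_def tangent_at_def)

lemma tangent_imp_supports:
  assumes "tangent_at \<Omega> x v" "v \<noteq> 0"
  shows "supports \<Omega> x v \<or> supports \<Omega> x (- v)"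
proof -
  obtain \<gamma> \<gamma>' \<gamma>'' T t k where p: "C2_boundary_param \<Omega> \<gamma> \<gamma>' \<gamma>'' T" and t: "\<gamma> t = x"
    and k: "v = k *\<^sub>R \<gamma>' t"
    using assms by (auto simp: tangent_at_def)
  have s: "supports \<Omega> x (\<gamma>' t)" using supports_velocity(1)[OF p, of t] t by simp
  consider "k > 0" | "- k > 0" using assms k by fastforce
  then show ?thesis
  proof cases
    case 1
    then show ?thesis using s k by (simp add: supports_scaleR)
  next
    case 2
    then have "supports \<Omega> x ((- k) *\<^sub>R \<gamma>' t)" using s supports_scaleR by blast
    then show ?thesis using k by simp
  qed
qed

lemma tangency_point_eqI:
  assumes "supports \<Omega> q (q - p)" "p \<notin> closure \<Omega>"
  shows "tangency_point \<Omega> p = q"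
proof -
  have "q' \<in> frontier \<Omega> \<and> positively_tangent_at \<Omega> q' (q' - p) \<longleftrightarrow> supports \<Omega> q' (q' - p)" for q'
    by (auto simp: positively_tangent_iff_supports supports_def)
  then show ?thesis
    unfolding tangency_point_def using ex1_supports_from[OF assms(2)] assms(1)
    by (intro the_equality) auto
qed

end

section \<open>Radon curves\<close>

locale radon_domain = C2_domain +
  assumes rad: "radon_boundary \<Omega>"
begin

lemma frontier_minus: "x \<in> frontier \<Omega> \<Longrightarrow> - x \<in> frontier \<Omega>"
  using rad by (auto simp: radon_boundary_def)

lemma frontier_subset_closure: "x \<in> frontier \<Omega> \<Longrightarrow> x \<in> closure \<Omega>"
  by (simp add: frontier_eq)

lemma zero_in: "0 \<in> \<Omega>"
proof -
  obtain \<gamma> \<gamma>' \<gamma>'' T where p: "C2_boundary_param \<Omega> \<gamma> \<gamma>' \<gamma>'' T"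
    using dom by (auto simp: C2_convex_domain_def)
  have T: "T > 0" and inj: "inj_on \<gamma> {0..<T}" using p by (auto simp: C2_boundary_param_def)
  have "\<gamma> 0 \<noteq> \<gamma> (T/2)" using inj_onD[OF inj, of 0 "T/2"] T by auto
  then obtain x where x: "x \<in> frontier \<Omega>" "x \<noteq> 0"
    using C2_boundary_param_in_frontier[OF p] by metis
  have ne: "x \<noteq> - x" using x(2) by (simp add: vec2_eq_iff) 
  have "0 \<in> open_segment x (- x)"
    using ne by (auto simp: in_segment intro!: exI[of _ "1/2"])
  then show ?thesis
    using open_segment_subset[of x "- x"] x ne frontier_minus frontier_subset_closure by blast
qed

lemma frontier_nonzero: "x \<in> frontier \<Omega> \<Longrightarrow> x \<noteq> 0"
  using zero_in frontier_eq by auto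

lemma scaled_in:
  assumes "x \<in> closure \<Omega>" "0 \<le> r" "r < 1"
  shows "r *\<^sub>R x \<in> \<Omega>"
proof (cases "r = 0 \<or> x = 0")
  case True
  then show ?thesis using zero_in by auto
next
  case False
  then have "r *\<^sub>R x \<in> open_segment 0 x"
    using assms by (auto simp: in_segment intro!: exI[of _ r])
  then show ?thesis
    using open_segment_subset[of 0 x] assms False zero_in closure_subset by blast
qed

text \<open>The domain is strictly star-shaped about the origin, so each ray meets the boundary once and
  every direction has a unique boundary vector.\<close>
lemma frontier_ray_unique:
  assumes "x \<in> frontier \<Omega>" "k *\<^sub>R x \<in> frontier \<Omega>" "k > 0"
  shows "k = 1"
proof (rule ccontr)
  assume "k \<noteq> 1"
  then consider "k < 1" | "inverse k < 1" using assms(3) one_less_inverse_iff[of "inverse k"] by fastforce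
  then show False
  proof cases
    case 1
    then show False using scaled_in[of x k] assms frontier_eq by auto
  next
    case 2
    then show False using scaled_in[of "k *\<^sub>R x" "inverse k"] assms frontier_eq by auto
  qed
qed

text \<open>The vectors \<open>x\<close> and \<open>y\<close> span a parallelogram whose vertices \<open>\<plusminus>x\<plusminus>y\<close> form a circumscribed
  parallelogram touching the curve at \<open>\<plusminus>x\<close> and \<open>\<plusminus>y\<close>.\<close>
definition conjugate :: "plane \<Rightarrow> plane \<Rightarrow> bool" where
  "conjugate x y \<longleftrightarrow> supports \<Omega> x y \<and> y \<in> frontier \<Omega>"

lemma conj_frontier: "conjugate x y \<Longrightarrow> x \<in> frontier \<Omega>" "conjugate x y \<Longrightarrow> y \<in> frontier \<Omega>"
  by (auto simp: conjugate_def supports_def)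

text \<open>The Radon property makes conjugation a symmetric relation of directions. The sign comes from
  the origin, which lies to the left of both tangents.\<close>
lemma conj_rotate:
  assumes "conjugate x y"
  shows "conjugate y (- x)"
proof -
  have x: "x \<in> frontier \<Omega>" and y: "y \<in> frontier \<Omega>" using assms conj_frontier by auto
  have pos: "cross2 y (0 - x) > 0"
    using supports_pos[of x y 0] assms zero_in by (simp add: conjugate_def)
  have "tangent_at \<Omega> y x"
    using rad x y supports_imp_tangent assms
    unfolding radon_boundary_def birkhoff_orthogonal_def conjugate_def by blast
  then have "supports \<Omega> y x \<or> supports \<Omega> y (- x)"
    using tangent_imp_supports frontier_nonzero[OF x] by blast
  moreover have "\<not> supports \<Omega> y x"
    using supports_pos[of y x 0] zero_in pos cross2_skew[of x y] by auto
  ultimately show ?thesis using x frontier_minus by (auto simp: conjugate_def)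
qed

lemma conj_minus: "conjugate x y \<Longrightarrow> conjugate (- x) (- y)"
  using conj_rotate conj_rotate by blast

lemma conj_rotate_back: "conjugate x y \<Longrightarrow> conjugate (- y) x"
  using conj_rotate conj_minus by fastforce

text \<open>These are the inequalities of the supporting lines at \<open>x\<close> and at \<open>y\<close>.\<close>
lemma conj_max:
  assumes "conjugate x y" "z \<in> closure \<Omega>"
  shows "cross2 z y \<le> cross2 x y" "cross2 x z \<le> cross2 x y"
proof -
  have "cross2 y (z - x) \<ge> 0" using assms by (auto simp: conjugate_def supports_def)
  then show "cross2 z y \<le> cross2 x y"
    using cross2_skew[of y z] cross2_skew[of y x] by (simp add: cross2_add)
  have "cross2 (- x) (z - y) \<ge> 0"
    using conj_rotate[OF assms(1)] assms(2) by (auto simp: conjugate_def supports_def)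
  then show "cross2 x z \<le> cross2 x y" by (simp add: cross2_add)
qed

lemma conj_max_unique:
  assumes "conjugate x y" "z \<in> closure \<Omega>" "cross2 z y = cross2 x y"
  shows "z = x"
proof (rule ccontr)
  assume "z \<noteq> x"
  then have "cross2 y (z - x) > 0"
    using supports_pos_closure assms by (auto simp: conjugate_def)
  then show False using assms(3) cross2_skew[of y z] cross2_skew[of y x] by (simp add: cross2_add)
qed

lemma conj_pos: "conjugate x y \<Longrightarrow> cross2 x y > 0"
  using supports_pos[of x y 0] zero_in cross2_skew[of x y] unfolding conjugate_def by simp

lemma normalize_to_frontier:
  assumes "v \<noteq> 0"
  obtains d where "d > 0" "d *\<^sub>R v \<in> frontier \<Omega>"
  using ray_to_frontier[OF bdd, of 0 v] zero_in opn assms by (auto simp: interior_open)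

lemma supports_imp_conj:
  assumes "supports \<Omega> x v"
  obtains d where "d > 0" "conjugate x (d *\<^sub>R v)"
proof -
  obtain d where "d > 0" "d *\<^sub>R v \<in> frontier \<Omega>"
    using normalize_to_frontier[of v] assms by (auto simp: supports_def)
  then show ?thesis using that assms by (simp add: conjugate_def supports_scaleR)
qed

lemma ex_conj: 
  assumes "x \<in> frontier \<Omega>"
  obtains y where "conjugate x y"
  using ex_supports[OF assms] supports_imp_conj by metis

lemma ex_conj_to: 
  assumes "y \<in> frontier \<Omega>"
  obtains x where "conjugate x y"
proof -
  obtain z where "conjugate y z" using ex_conj[OF assms] by blast
  from conj_rotate_back[OF this] have "conjugate (- z) y" .
  then show ?thesis by (rule that)
qed

text \<open>Moving a conjugate pair moves each vector in the direction of the other, so the area form of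
  the pair has derivative zero. Without differentiating the second vector, maximality traps the
  increment between two quadratically small quantities.\<close>
lemma conj_cross2_const:
  assumes "conjugate x y" "conjugate x' y'"
  shows "cross2 x y = cross2 x' y'"
proof -
  obtain \<gamma> \<gamma>' \<gamma>'' T where p: "C2_boundary_param \<Omega> \<gamma> \<gamma>' \<gamma>'' T"
    using dom by (auto simp: C2_convex_domain_def)
  have d1: "\<And>t. (\<gamma> has_vector_derivative \<gamma>' t) (at t)"
    and d2: "\<And>t. (\<gamma>' has_vector_derivative \<gamma>'' t) (at t)"
    and cont: "continuous_on UNIV \<gamma>''"
    and im: "\<gamma> ` {0..<T} = frontier \<Omega>"
    using p by (auto simp: C2_boundary_param_def)
  have fr: "\<gamma> s \<in> frontier \<Omega>" for s using C2_boundary_param_in_frontier[OF p] .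
  have "\<exists>d>0. conjugate (\<gamma> t) (d *\<^sub>R \<gamma>' t)" for t
    using supports_imp_conj[OF supports_velocity(1)[OF p]] by metis
  then obtain d where d: "\<And>t. d t > 0" "\<And>t. conjugate (\<gamma> t) (d t *\<^sub>R \<gamma>' t)" by metis
  define Y where "Y t = d t *\<^sub>R \<gamma>' t" for t
  have Y: "conjugate (\<gamma> t) (Y t)" for t using d by (simp add: Y_def)
  \<comment> \<open>\<open>Y t\<close> is the only conjugate of \<open>\<gamma> t\<close>, so every pair is covered by the parametrization.\<close>
  have uniq: "y = Y t" if "conjugate (\<gamma> t) y" for y t
  proof -
    from supports_velocity(2)[OF p] that obtain k where k: "k > 0" "y = k *\<^sub>R \<gamma>' t"
      by (auto simp: conjugate_def)
    then have "y = (k / d t) *\<^sub>R Y t" using d(1)[of t] by (simp add: Y_def)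
    moreover have "k / d t > 0" using k(1) d(1)[of t] by simp
    ultimately show ?thesis
      using frontier_ray_unique[of "Y t" "k / d t"] conj_frontier(2)[OF Y[of t]]
        conj_frontier(2)[OF that] by simp
  qed
  obtain R where R: "\<And>z. z \<in> closure \<Omega> \<Longrightarrow> norm z \<le> R"
    using compact_imp_bounded[OF compact_closure] by (auto simp: bounded_iff)
  have "compact (\<gamma>'' ` {0..T})"
    using cont by (intro compact_continuous_image) (auto intro: continuous_on_subset)
  then obtain B where B: "\<And>t. t \<in> {0..T} \<Longrightarrow> norm (\<gamma>'' t) \<le> B"
    using compact_imp_bounded by (fastforce simp: bounded_iff)
  define M where "M = R * B"
  \<comment> \<open>Since \<open>Y u\<close> is tangent at \<open>\<gamma> u\<close>, the chord from there deviates from it to second order only.\<close>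
  have quad: "\<bar>cross2 (Y u) (\<gamma> s - \<gamma> u)\<bar> \<le> M * (s - u)\<^sup>2" if su: "s \<in> {0..T}" "u \<in> {0..T}" for s u
  proof -
    have D1: "\<And>w. ((\<lambda>s. cross2 (Y u) (\<gamma> s)) has_real_derivative cross2 (Y u) (\<gamma>' w)) (at w)"
      and D2: "\<And>w. ((\<lambda>s. cross2 (Y u) (\<gamma>' s)) has_real_derivative cross2 (Y u) (\<gamma>'' w)) (at w)"
      using has_derivative_cross2_curve d1 d2 by blast+
    have b2: "\<bar>cross2 (Y u) (\<gamma>'' w)\<bar> \<le> M" if "w \<in> {0..T}" for w
    proof -
      have "norm (Y u) * norm (\<gamma>'' w) \<le> R * B"
        using R[OF frontier_subset_closure[OF conj_frontier(2)[OF Y[of u]]]] B[OF that] 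
        by (intro mult_mono) (auto intro: order_trans[OF norm_ge_zero])
      then show ?thesis using abs_cross2_le[of "Y u" "\<gamma>'' w"] by (simp add: M_def)
    qed
    have M0: "M \<ge> 0" using b2[OF su(1)] by linarith
    have b1: "\<bar>cross2 (Y u) (\<gamma>' w)\<bar> \<le> M * \<bar>s - u\<bar>" if w: "w \<in> {0..T}" "\<bar>w - u\<bar> \<le> \<bar>s - u\<bar>" for w
    proof -
      have "norm (cross2 (Y u) (\<gamma>' w) - cross2 (Y u) (\<gamma>' u)) \<le> M * norm (w - u)"
        by (rule field_differentiable_bound[of "{0..T}" "\<lambda>s. cross2 (Y u) (\<gamma>' s)"])
          (use D2 b2 w su in \<open>auto intro: has_field_derivative_at_within\<close>)
      moreover have "cross2 (Y u) (\<gamma>' u) = 0" by (simp add: Y_def)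
      moreover have "M * \<bar>w - u\<bar> \<le> M * \<bar>s - u\<bar>" using w(2) M0 by (intro mult_left_mono)
      ultimately show ?thesis by simp
    qed
    have "norm (cross2 (Y u) (\<gamma> s) - cross2 (Y u) (\<gamma> u)) \<le> (M * \<bar>s - u\<bar>) * norm (s - u)"
    proof (rule field_differentiable_bound[of "closed_segment s u" "\<lambda>s. cross2 (Y u) (\<gamma> s)"
          "\<lambda>w. cross2 (Y u) (\<gamma>' w)"])
      fix w assume w: "w \<in> closed_segment s u"
      show "((\<lambda>s. cross2 (Y u) (\<gamma> s)) has_real_derivative cross2 (Y u) (\<gamma>' w))
          (at w within closed_segment s u)"
        using D1 by (rule has_field_derivative_at_within)
      have "w \<in> {0..T} \<and> \<bar>w - u\<bar> \<le> \<bar>s - u\<bar>"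
        using w su by (simp add: closed_segment_eq_real_ivl split: if_splits)
      then show "norm (cross2 (Y u) (\<gamma>' w)) \<le> M * \<bar>s - u\<bar>" using b1 by simp
    qed auto
    then show ?thesis by (simp add: cross2_add power2_eq_square mult.assoc flip: abs_mult)
  qed
  have "\<bar>cross2 (\<gamma> s) (Y s) - cross2 (\<gamma> t) (Y t)\<bar> \<le> M * (s - t)\<^sup>2" 
    if st: "s \<in> {0..T}" "t \<in> {0..T}" for s t
  proof -
    have "cross2 (\<gamma> s) (Y t) \<le> cross2 (\<gamma> s) (Y s)" "cross2 (\<gamma> t) (Y s) \<le> cross2 (\<gamma> t) (Y t)"
      using conj_max(2)[OF Y] frontier_subset_closure conj_frontier(2)[OF Y] by blast+
    moreover have "cross2 (\<gamma> s) (Y t) = cross2 (\<gamma> t) (Y t) - cross2 (Y t) (\<gamma> s - \<gamma> t)"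
      "cross2 (\<gamma> t) (Y s) = cross2 (\<gamma> s) (Y s) - cross2 (Y s) (\<gamma> t - \<gamma> s)"
      by (simp_all add: cross2_def algebra_simps)
    ultimately show ?thesis
      using quad[OF st(1) st(2)] quad[OF st(2) st(1)] power2_commute[of s t] by auto
  qed
  then obtain c where c: "\<And>s. s \<in> {0..T} \<Longrightarrow> cross2 (\<gamma> s) (Y s) = c"
    using constant_if_quadratic_variation[of "{0..T}" "\<lambda>s. cross2 (\<gamma> s) (Y s)" M] by auto
  have "cross2 x y = c" if xy: "conjugate x y" for x y
  proof -
    obtain t where t: "t \<in> {0..<T}" "x = \<gamma> t" using conj_frontier(1)[OF xy] im by blast
    then show ?thesis using c[of t] uniq[of t y] xy by auto
  qed
  then show ?thesis using assms by simp
qed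

text \<open>Every boundary vector belongs to a conjugate pair and the maximum over its pair is the common
  constant. In other words, a quarter turn maps the gauge of the domain to a multiple of its dual
  norm.\<close>
lemma abs_cross2_le_conj:
  assumes "conjugate x y" "u \<in> closure \<Omega>" "v \<in> closure \<Omega>"
  shows "\<bar>cross2 u v\<bar> \<le> cross2 x y"
proof -
  have *: "cross2 u w \<le> cross2 x y" if w: "w \<in> frontier \<Omega>" for w
  proof -
    obtain x' where x': "conjugate x' w" using ex_conj_to[OF w] by blast
    show ?thesis using conj_max(1)[OF x' assms(2)] conj_cross2_const[OF assms(1) x'] by simp
  qed
  show ?thesis
  proof (cases "v = 0")
    case True
    then show ?thesis using conj_pos[OF assms(1)] by simp
  next
    case False
    then obtain d where d: "d > 0" "d *\<^sub>R v \<in> frontier \<Omega>" using normalize_to_frontier by blast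
    have "d \<ge> 1" using scaled_in[OF assms(3), of d] d frontier_eq by force
    have "\<bar>cross2 u (d *\<^sub>R v)\<bar> \<le> cross2 x y"
      using *[OF d(2)] *[OF frontier_minus[OF d(2)]] by simp
    moreover have "\<bar>cross2 u v\<bar> * 1 \<le> \<bar>cross2 u v\<bar> * d"
      using \<open>d \<ge> 1\<close> by (intro mult_left_mono) auto
    ultimately show ?thesis using d(1) by (simp add: abs_mult mult.commute)
  qed
qed

end

section \<open>Addition of signed angles\<close>

lemma norm_signed_angle_arg: "cmod (Complex (u \<bullet> v) (cross2 u v)) = norm u * norm v"
proof -
  have "(cmod (Complex (u \<bullet> v) (cross2 u v)))\<^sup>2 = (norm u * norm v)\<^sup>2"
    using lagrange_cross2[of u v] by (simp add: cmod_power2 power_mult_distrib)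
  then show ?thesis by (simp add: power2_eq_iff_nonneg)
qed

lemma signed_angle_scaleR:
  assumes "k > 0" "l > 0"
  shows "signed_angle (k *\<^sub>R u) (l *\<^sub>R v) = signed_angle u v"
proof -
  have "Complex ((k *\<^sub>R u) \<bullet> (l *\<^sub>R v)) (cross2 (k *\<^sub>R u) (l *\<^sub>R v))
      = of_real (k * l) * Complex (u \<bullet> v) (cross2 u v)"
    by (simp add: complex_eq_iff)
  then show ?thesis
    using assms Arg_times_of_real[of "k * l" "Complex (u \<bullet> v) (cross2 u v)"]
    unfolding signed_angle_def by (metis mult_pos_pos)
qed

lemma abs_signed_angle_le: "\<bar>signed_angle u v\<bar> \<le> pi"
  using Arg_bounded[of "Complex (u \<bullet> v) (cross2 u v)"] by (simp add: signed_angle_def abs_le_iff)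

text \<open>Two angles in \<open>[0, \<pi>]\<close> can only fail to add up by a full turn, which the sign of the total
  excludes.\<close>
lemma signed_angle_add:
  assumes "u \<noteq> 0" "v \<noteq> 0" "w \<noteq> 0"
    and "cross2 u v \<ge> 0" "cross2 v w \<ge> 0" "cross2 u w > 0"
  shows "signed_angle u w = signed_angle u v + signed_angle v w"
proof -
  let ?a = "Complex (u \<bullet> v) (cross2 u v)" and ?b = "Complex (v \<bullet> w) (cross2 v w)"
  let ?c = "Complex (u \<bullet> w) (cross2 u w)"
  have nz: "?a \<noteq> 0" "?b \<noteq> 0"
    using norm_signed_angle_arg[of u v] norm_signed_angle_arg[of v w] assms(1-3)
    by (metis mult_eq_0_iff norm_eq_zero)+
  have "?a * ?b = of_real ((norm v)\<^sup>2) * ?c"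
    unfolding power2_norm_eq_inner by (simp add: complex_eq_iff inner2 cross2_def algebra_simps)
  then have prod: "Arg (?a * ?b) = Arg ?c"
    using assms(2) Arg_times_of_real[of "(norm v)\<^sup>2" ?c] by (simp only: zero_less_power2 norm_eq_zero not_False_eq_True)
  have pos: "Arg ?a \<ge> 0" "Arg ?b \<ge> 0" using assms by (auto simp: Arg_less_0)
  have "Arg ?c > 0" using Arg_lt_pi[of ?c] assms by simp
  then show ?thesis
    using Arg_times'[OF nz] prod pos Arg_le_pi[of ?a] Arg_le_pi[of ?b]
    by (auto simp: signed_angle_def split: if_splits)
qed

lemma signed_angle_supplement:
  assumes "cross2 x y > 0"
  shows "signed_angle x y + signed_angle y (- x) = pi"
proof -
  let ?a = "Complex (x \<bullet> y) (cross2 x y)" and ?b = "Complex (- (y \<bullet> x)) (- cross2 y x)"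
  have c: "cross2 y x = - cross2 x y" by (rule cross2_skew)
  have nz: "?a \<noteq> 0" "?b \<noteq> 0" using assms c by (auto simp: complex_eq_iff)
  have "?a * ?b = of_real (- ((x \<bullet> y)\<^sup>2 + (cross2 x y)\<^sup>2))"
    by (simp add: complex_eq_iff c inner_commute power2_eq_square)
  moreover have "(x \<bullet> y)\<^sup>2 + (cross2 x y)\<^sup>2 > 0"
    using assms by (simp add: add_nonneg_pos)
  then have "- ((x \<bullet> y)\<^sup>2 + (cross2 x y)\<^sup>2) < 0" by linarith
  ultimately have "Arg (?a * ?b) = pi" by (simp only: Arg_of_real if_True)
  moreover have "Arg ?a > 0" "Arg ?b > 0" using Arg_lt_pi[of ?a] Arg_lt_pi[of ?b] assms c by auto
  ultimately show ?thesis
    using Arg_times'[OF nz] Arg_le_pi[of ?a] Arg_le_pi[of ?b] 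
    by (auto simp: signed_angle_def split: if_splits)
qed

text \<open>The left-hand side is the sine of the angle.\<close>
lemma cross2_le_signed_angle:
  assumes "cross2 u v \<ge> 0" "u \<noteq> 0" "v \<noteq> 0"
  shows "cross2 u v / (norm u * norm v) \<le> signed_angle u v"
proof -
  let ?a = "Complex (u \<bullet> v) (cross2 u v)"
  have n: "cmod ?a = norm u * norm v" by (rule norm_signed_angle_arg)
  then have nz: "?a \<noteq> 0" using assms by (metis mult_eq_0_iff norm_eq_zero)
  have "sin (Arg ?a) = cross2 u v / (norm u * norm v)"
    using cis_Arg[OF nz] n by (metis Im_sgn cis.sel(2) complex.sel(2))
  moreover have "Arg ?a \<ge> 0" using assms by (simp add: Arg_less_0)
  ultimately show ?thesis using sin_x_le_x[of "Arg ?a"] by (simp add: signed_angle_def)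
qed

section \<open>Outer billiard steps on a Radon domain\<close>

context radon_domain
begin

lemma conj_tangent_notin_closure:
  assumes "conjugate x y" "s \<noteq> 0"
  shows "x + s *\<^sub>R y \<notin> closure \<Omega>"
  using conj_max_unique[OF assms(1), of "x + s *\<^sub>R y"] assms frontier_nonzero[OF conj_frontier(2)]
  by (auto simp: cross2_add)

lemma outer_billiard_conj:
  assumes "conjugate x y" "s > 0"
  shows "outer_billiard \<Omega> (x - s *\<^sub>R y) = x + s *\<^sub>R y"
proof -
  have "supports \<Omega> x (x - (x - s *\<^sub>R y))"
    using assms by (simp add: conjugate_def supports_scaleR)
  moreover have "x - s *\<^sub>R y \<notin> closure \<Omega>"
    using conj_tangent_notin_closure[OF assms(1), of "- s"] assms(2) by simp
  ultimately have "tangency_point \<Omega> (x - s *\<^sub>R y) = x" by (rule tangency_point_eqI)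
  then show ?thesis by (simp add: outer_billiard_def algebra_simps scaleR_2)
qed

text \<open>The coordinate \<open>s\<close> is the tangent length measured in the gauge of the domain. It carries the
  whole dynamics: the action of a step is proportional to it.\<close>
lemma exterior_point_decomp:
  assumes "p \<notin> closure \<Omega>"
  obtains x y s where "conjugate x y" "s > 0" "p = x - s *\<^sub>R y"
proof -
  obtain x where x: "supports \<Omega> x (x - p)" using ex1_supports_from[OF assms] by blast
  then obtain d where d: "d > 0" "conjugate x (d *\<^sub>R (x - p))" using supports_imp_conj by blast
  then show ?thesis
    using that[of x "d *\<^sub>R (x - p)" "1 / d"] by simp
qed

text \<open>Written in the basis of one conjugate pair, the next one has coordinates of absolute value at
  most 1 and determinant 1. Together with the uniqueness of contact points, these bounds force the
  invariance of the curve \<open>{x + y}\<close> traced by the vertices of the circumscribed parallelograms: a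
  step of length ratio at most 1 is followed by another such step.\<close>
lemma outer_billiard_step:
  assumes xy: "conjugate x y" and xy': "conjugate x' y'" and s: "s > 0" "s' > 0"
    and eq: "x + s *\<^sub>R y = x' - s' *\<^sub>R y'" and s1: "s \<le> 1"
  shows "s' \<le> 1" "cross2 x' y \<ge> 0" "cross2 x y' \<ge> 0" "cross2 y y' > 0"
    and "cross2 x y * (1 - s) \<le> cross2 x y'"
proof -
  define c where "c = cross2 x y"
  have c': "cross2 x' y' = c" using conj_cross2_const[OF xy xy'] by (simp add: c_def)
  have c0: "c > 0" using conj_pos[OF xy] by (simp add: c_def)
  note cl = conj_frontier[OF xy] conj_frontier[OF xy']
  note bnd = abs_cross2_le_conj[OF xy frontier_subset_closure frontier_subset_closure, folded c_def]
  \<comment> \<open>In the basis \<open>x\<close>, \<open>y\<close> the new pair is \<open>x' = a x + e y\<close> and \<open>y' = - d x + b y\<close>.\<close>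
  define a b d e where "a = cross2 x' y / c" and "b = cross2 x y' / c"
    and "d = cross2 y y' / c" and "e = cross2 x x' / c"
  have le: "\<bar>a\<bar> \<le> 1" "\<bar>b\<bar> \<le> 1" "\<bar>d\<bar> \<le> 1" "\<bar>e\<bar> \<le> 1"
    using bnd[OF cl(3) cl(2)] bnd[OF cl(1) cl(4)] bnd[OF cl(2) cl(4)] bnd[OF cl(1) cl(3)] c0
    by (simp_all add: a_def b_def d_def e_def)
  have "c * c = cross2 x' y * cross2 x y' + cross2 x x' * cross2 y y'"
    using cross2_pluecker[of x y x' y'] c' by (simp add: c_def)
  moreover have "a * b + e * d = (cross2 x' y * cross2 x y' + cross2 x x' * cross2 y y') / (c * c)"
    by (simp add: a_def b_def d_def e_def add_divide_distrib)
  ultimately have "a * b + e * d = c * c / (c * c)" by (simp only:)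
  then have det: "a * b + e * d = 1" using c0 by simp
  have "cross2 (x + s *\<^sub>R y) y = cross2 (x' - s' *\<^sub>R y') y" using eq by simp
  then have "c = cross2 x' y - s' * cross2 y' y" by (simp add: cross2_add c_def)
  then have "c = cross2 x' y + s' * cross2 y y'" unfolding cross2_skew[of y' y] by simp
  moreover have "a + s' * d = (cross2 x' y + s' * cross2 y y') / c"
    by (simp add: a_def d_def add_divide_distrib)
  ultimately have 1: "a + s' * d = 1" using c0 by (metis divide_self less_irrefl)
  have "cross2 (x + s *\<^sub>R y) y' = cross2 (x' - s' *\<^sub>R y') y'" using eq by simp
  then have "c = cross2 x y' + s * cross2 y y'" by (simp add: cross2_add c')
  moreover have "b + s * d = (cross2 x y' + s * cross2 y y') / c"
    by (simp add: b_def d_def add_divide_distrib)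
  ultimately have 2: "b + s * d = 1" using c0 by (metis divide_self less_irrefl)
  have "s * d \<ge> 0" using 2 le by linarith
  then have d0: "d \<ge> 0" using s by (simp add: zero_le_mult_iff)
  \<comment> \<open>If \<open>d = 0\<close>, the two tangent lines coincide and the step has no length.\<close>
  have "d \<noteq> 0"
  proof
    assume d: "d = 0"
    then have "x' = x"
      using conj_max_unique[OF xy, of x'] frontier_subset_closure cl 1 c0 by (simp add: a_def c_def)
    moreover have "y' = y"
    proof -
      have "conjugate y (- x)" using conj_rotate[OF xy] .
      moreover have "cross2 y' (- x) = cross2 y (- x)"
        using 2 d c0 cross2_skew[of y' x] cross2_skew[of y x] by (simp add: b_def c_def)
      ultimately show ?thesis
        using conj_max_unique frontier_subset_closure cl by blast
    qed
    ultimately have "(s + s') *\<^sub>R y = 0" using eq by (simp add: algebra_simps)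
    then show False using s frontier_nonzero[OF cl(2)] by auto
  qed
  with d0 have dpos: "d > 0" by simp
  have "s * d \<le> 1 * 1" using s1 le s d0 by (intro mult_mono) auto
  then have b0: "b \<ge> 0" using 2 by linarith
  \<comment> \<open>If \<open>a < 0\<close>, the determinant forces \<open>e = 1\<close>, hence \<open>x' = y\<close> and \<open>a = 0\<close>.\<close>
  have a0: "a \<ge> 0"
  proof (rule ccontr)
    assume a: "\<not> a \<ge> 0"
    then have "a * b \<le> 0" using b0 by (simp add: mult_le_0_iff)
    then have ed: "e * d \<ge> 1" using det by linarith
    have "e * d \<le> 1 * d" using le dpos by (intro mult_right_mono) auto
    then have "d = 1" using ed le by linarith
    then have "e = 1" using ed le by simp
    then have "cross2 x' (- x) = cross2 y (- x)"
      using c0 cross2_skew[of x' x] cross2_skew[of y x] by (simp add: e_def c_def)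
    then have "x' = y"
      using conj_max_unique[OF conj_rotate[OF xy], of x'] frontier_subset_closure cl by blast
    then show False using a by (simp add: a_def)
  qed
  \<comment> \<open>Now \<open>d \<ge> e d = 1 - a b \<ge> 1 - a = s' d\<close>.\<close>
  have "e * d \<le> 1 * d" using le dpos by (intro mult_right_mono) auto
  moreover have "a * b \<le> a * 1" using le a0 by (intro mult_left_mono) auto
  ultimately have "s' * d \<le> 1 * d" using det 1 by linarith
  then show "s' \<le> 1" using dpos by simp
  show "cross2 x' y \<ge> 0" "cross2 x y' \<ge> 0" "cross2 y y' > 0"
    using a0 b0 dpos c0 by (auto simp: a_def b_def d_def zero_le_divide_iff zero_less_divide_iff)
  have "s * d \<le> s * 1" using le s by (intro mult_left_mono) auto
  then have "1 - s \<le> b" using 2 by linarith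
  then show "cross2 x y * (1 - s) \<le> cross2 x y'"
    using c0 by (simp add: b_def field_simps flip: c_def)
qed

text \<open>The angles from \<open>x\<close> to \<open>y\<close>, from \<open>y\<close> to \<open>y'\<close> and from \<open>y'\<close> to \<open>- x\<close> add up to \<open>\<pi>\<close>. The last one
  measures how much the step lags behind a quarter turn, and it dominates the defect \<open>1 - s\<close>.\<close>
lemma step_length_ge_turning:
  assumes xy: "conjugate x y" and xy': "conjugate x' y'" and s: "s > 0" "s' > 0"
    and eq: "x + s *\<^sub>R y = x' - s' *\<^sub>R y'" and s1: "s \<le> 1"
    and R: "\<And>z. z \<in> closure \<Omega> \<Longrightarrow> norm z \<le> R"
  shows "s \<ge> 1 - R\<^sup>2 / cross2 x y *
    (pi - 2 * signed_angle y y' + signed_angle x' y' - signed_angle x y)"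
proof -
  note st = outer_billiard_step[OF assms(1-6)]
  note fr = conj_frontier[OF xy] conj_frontier[OF xy']
  note nz = fr[THEN frontier_nonzero]
  have c0: "cross2 x y > 0" using conj_pos[OF xy] .
  have rot: "cross2 y (- x) = cross2 x y" "cross2 y' (- x) = cross2 x y'"
    using cross2_skew[of x y] cross2_skew[of x y'] by auto
  have "signed_angle y (- x) = signed_angle y y' + signed_angle y' (- x)"
    using signed_angle_add[of y y' "- x"] nz st rot c0 by simp
  then have 1: "signed_angle x y + signed_angle y y' + signed_angle y' (- x) = pi"
    using signed_angle_supplement[OF c0] by linarith
  have "signed_angle x' y' = signed_angle x' y + signed_angle y y'"
    using signed_angle_add[of x' y y'] nz st conj_pos[OF xy'] by simp
  moreover have "signed_angle x' y \<ge> 0"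
    unfolding signed_angle_def using st by (simp add: Arg_less_0)
  ultimately have 2: "signed_angle y' (- x)
      \<le> pi - 2 * signed_angle y y' + signed_angle x' y' - signed_angle x y" (is "_ \<le> ?A")
    using 1 by linarith
  have "cross2 x y' / R\<^sup>2 \<le> cross2 x y' / (norm y' * norm (- x))"
  proof (rule divide_left_mono)
    show "norm y' * norm (- x) \<le> R\<^sup>2"
      unfolding power2_eq_square using R[OF frontier_subset_closure] fr
      by (intro mult_mono) (auto intro: order_trans[OF norm_ge_zero])
    moreover have "norm y' * norm (- x) > 0" using nz by simp
    ultimately show "0 < R\<^sup>2 * (norm y' * norm (- x))"
      by (intro mult_pos_pos[of "R\<^sup>2"]) linarith+
  qed (use st in auto)
  also have "\<dots> \<le> signed_angle y' (- x)"
    unfolding rot(2)[symmetric]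
    by (rule cross2_le_signed_angle) (use st(3) rot(2) nz in auto)
  finally have "cross2 x y' / R\<^sup>2 \<le> ?A" using 2 by linarith
  moreover have R0: "R\<^sup>2 > 0"
    using nz(1) R[OF frontier_subset_closure[OF fr(1)]] by (auto simp: zero_less_power2)
  ultimately have "cross2 x y' \<le> R\<^sup>2 * ?A" by (simp add: field_simps)
  then have "cross2 x y * (1 - s) \<le> R\<^sup>2 * ?A" using st(5) by linarith
  then have "1 - s \<le> R\<^sup>2 / cross2 x y * ?A" using c0 by (simp add: field_simps)
  then show ?thesis by linarith
qed

end

section \<open>The beta function of a Radon domain at one quarter\<close>

lemma bounded_over_n_tendsto_0:
  fixes A :: "nat \<Rightarrow> real"
  assumes "\<And>n. \<bar>A n\<bar> \<le> B"
  shows "(\<lambda>n. A n / real n) \<longlonglongrightarrow> 0"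
proof (rule Lim_null_comparison)
  show "\<forall>\<^sub>F n in sequentially. norm (A n / real n) \<le> B / real n"
    using assms by (auto intro!: always_eventually divide_right_mono)
  show "(\<lambda>n. B / real n) \<longlonglongrightarrow> 0" by (rule lim_const_over_n)
qed

lemma mean_nonneg_if_eventually_nonneg:
  fixes D :: "nat \<Rightarrow> real"
  assumes lim: "(\<lambda>N. (\<Sum>n<N. D n) / real N) \<longlonglongrightarrow> l" and D: "\<And>n. n \<ge> n0 \<Longrightarrow> D n \<ge> 0"
  shows "l \<ge> 0"
proof (rule tendsto_le[OF _ lim lim_const_over_n[of "\<Sum>n<n0. D n"]])
  show "\<forall>\<^sub>F N in sequentially. (\<Sum>n<n0. D n) / real N \<le> (\<Sum>n<N. D n) / real N"
  proof (rule eventually_sequentiallyI[of n0])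
    fix N assume "n0 \<le> N"
    then have "(\<Sum>n<n0. D n) \<le> (\<Sum>n<N. D n)"
      using D by (intro sum_mono2) auto
    then show "(\<Sum>n<n0. D n) / real N \<le> (\<Sum>n<N. D n) / real N"
      by (rule divide_right_mono) simp
  qed
qed simp

context radon_domain
begin

lemma outer_orbit_notin_closure:
  assumes "outer_orbit \<Omega> p"
  shows "p n \<notin> closure \<Omega>"
proof (induction n)
  case 0
  then show ?case using assms by (simp add: outer_orbit_def)
next
  case (Suc n)
  then obtain x y s where xy: "conjugate x y" and s: "s > 0" and p: "p n = x - s *\<^sub>R y"
    by (rule exterior_point_decomp)
  have "p (Suc n) = x + s *\<^sub>R y"
    using assms outer_billiard_conj[OF xy s] p by (simp add: outer_orbit_def)
  then show ?case using conj_tangent_notin_closure[OF xy, of s] s by simp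
qed

text \<open>The vertices of a circumscribed parallelogram \<open>\<plusminus>x\<plusminus>y\<close> form an orbit of period 4. Its turning
  angles alternate between two supplementary values, so they average to a quarter turn.\<close>
lemma quarter_orbit:
  assumes "conjugate x y"
  shows "\<exists>p. outer_orbit \<Omega> p \<and> has_rotation_number p (1/4) \<and> has_mean_action p (cross2 x y)"
proof -
  \<comment> \<open>Conjugation maps the pair \<open>(x, y)\<close> to \<open>(y, - x)\<close>, a rotation of order 4.\<close>
  define P where "P n = ((\<lambda>(x, y). (y, - x)) ^^ n) (x, y)" for n :: nat
  define X Y where "X n = fst (P n)" and "Y n = snd (P n)" for n
  have XY0: "X 0 = x" "Y 0 = y" by (simp_all add: X_def Y_def P_def)
  have XYS: "X (Suc n) = Y n" "Y (Suc n) = - X n" for n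
    by (simp_all add: X_def Y_def P_def case_prod_unfold)
  have conj: "conjugate (X n) (Y n)" for n
    by (induction n) (simp_all add: XY0 XYS assms conj_rotate)
  define p where "p n = X n - Y n" for n
  have step: "p (Suc n) = X n + Y n" for n by (simp add: p_def XYS)
  have "p (Suc n) = outer_billiard \<Omega> (p n)" for n
    using outer_billiard_conj[OF conj, of 1 n] unfolding step by (simp add: p_def)
  moreover have "p 0 \<notin> closure \<Omega>"
    using conj_tangent_notin_closure[OF conj, of "-1" 0] by (simp add: p_def)
  ultimately have orb: "outer_orbit \<Omega> p" by (simp add: outer_orbit_def)
  define A where "A n = signed_angle (X n) (Y n)" for n
  have turn: "signed_angle (p (Suc n) - p n) (p (Suc (Suc n)) - p (Suc n))
      = pi/2 + (A (Suc n) - A n) / 2" for n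
  proof -
    have "p (Suc n) - p n = 2 *\<^sub>R Y n" for n
      unfolding step by (simp add: p_def scaleR_2)
    then have "signed_angle (p (Suc n) - p n) (p (Suc (Suc n)) - p (Suc n))
        = signed_angle (Y n) (Y (Suc n))"
      using signed_angle_scaleR[of 2 2] by simp
    moreover have "A (Suc n) = signed_angle (Y n) (Y (Suc n))" by (simp add: A_def XYS)
    moreover have "A n + signed_angle (Y n) (Y (Suc n)) = pi"
      using signed_angle_supplement[OF conj_pos[OF conj]] by (simp add: A_def XYS)
    ultimately show ?thesis by (simp add: field_simps)
  qed
  have "(\<Sum>n<N. pi/2 + (A (Suc n) - A n) / 2) = real N * (pi/2) + (A N - A 0) / 2" for N
    using sum_lessThan_telescope[of A N] by (simp add: sum.distrib flip: sum_divide_distrib)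
  then have rot: "(\<lambda>N. (\<Sum>n<N. signed_angle (p (Suc n) - p n) (p (Suc (Suc n)) - p (Suc n)))
      / (2 * pi) / real N) = (\<lambda>N. real N / real N * (1/4) + (A N - A 0) / real N * (1 / (4 * pi)))"
    by (intro ext) (simp add: turn add_divide_distrib)
  have An: "(\<lambda>N. (A N - A 0) / real N) \<longlonglongrightarrow> 0"
  proof (rule bounded_over_n_tendsto_0)
    show "\<bar>A n - A 0\<bar> \<le> 2 * pi" for n
      using abs_signed_angle_le[of "X n" "Y n"] abs_signed_angle_le[of "X 0" "Y 0"]
      by (simp add: A_def)
  qed
  have one: "(\<lambda>N. real N / real N) \<longlonglongrightarrow> 1"
    by (rule tendsto_eventually) (auto intro: eventually_sequentiallyI[of 1])
  have "(\<lambda>N. real N / real N * (1/4) + (A N - A 0) / real N * (1 / (4 * pi)))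
      \<longlonglongrightarrow> 1 * (1/4) + 0 * (1 / (4 * pi))"
    by (intro tendsto_intros one An)
  then have "has_rotation_number p (1/4)"
    unfolding has_rotation_number_def rot by simp
  moreover have "has_mean_action p (cross2 x y)"
  proof -
    have "outer_action (p n) (p (Suc n)) = cross2 (X n) (Y n)" for n
      unfolding step
      by (simp add: outer_action_def p_def cross2_add cross2_skew[of "Y n" "X n"])
    then have "outer_action (p n) (p (Suc n)) = cross2 x y" for n
      using conj_cross2_const[OF assms conj[of n]] by simp
    then have "(\<lambda>N. (\<Sum>n<N. outer_action (p n) (p (Suc n))) / real N)
        = (\<lambda>N. real N / real N * cross2 x y)" by (simp add: fun_eq_iff)
    then show ?thesis
      unfolding has_mean_action_def using tendsto_mult_right[OF one, of "cross2 x y"] by simp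
  qed
  ultimately show ?thesis using orb by blast
qed

text \<open>An orbit whose tangent lengths all exceed 1 has action at least \<open>cross2 x y\<close> at every step. Any
  other orbit stays on or inside the invariant curve from some time on, where the turning estimate
  averages to the claim because the mean turn is a quarter.\<close>
lemma mean_action_ge:
  assumes xy: "conjugate x y" and orb: "outer_orbit \<Omega> p" and rot: "has_rotation_number p (1/4)"
    and act: "has_mean_action p a"
  shows "a \<ge> cross2 x y"
proof -
  define c where "c = cross2 x y"
  have c0: "c > 0" using conj_pos[OF xy] by (simp add: c_def)
  have "\<forall>n. \<exists>x y s. conjugate x y \<and> s > 0 \<and> p n = x - s *\<^sub>R y"
    using exterior_point_decomp[OF outer_orbit_notin_closure[OF orb]] by metis
  then obtain X Y S where XY: "\<And>n. conjugate (X n) (Y n)" and S: "\<And>n. S n > 0"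
    and p: "\<And>n. p n = X n - S n *\<^sub>R Y n" by metis
  have step: "p (Suc n) = X n + S n *\<^sub>R Y n" for n
    using orb outer_billiard_conj[OF XY S] p by (simp add: outer_orbit_def)
  have cc: "cross2 (X n) (Y n) = c" for n using conj_cross2_const[OF xy XY] by (simp add: c_def)
  have "outer_action (p n) (p (Suc n)) = S n * cross2 (X n) (Y n)" for n
    unfolding step unfolding p
    by (simp add: outer_action_def cross2_add cross2_skew[of "Y n" "X n"])
  then have "(\<Sum>n<N. outer_action (p n) (p (Suc n))) = c * (\<Sum>n<N. S n)" for N
    by (simp add: cc sum_distrib_left mult.commute)
  then have "(\<lambda>N. c * (\<Sum>n<N. S n) / real N) \<longlonglongrightarrow> a"
    using act by (simp add: has_mean_action_def)
  from tendsto_divide[OF this tendsto_const[of c]]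
  have meanS: "(\<lambda>N. (\<Sum>n<N. S n) / real N) \<longlonglongrightarrow> a / c" using c0 by simp
  define \<Delta> where "\<Delta> n = signed_angle (Y n) (Y (Suc n))" for n
  have "signed_angle (p (Suc n) - p n) (p (Suc (Suc n)) - p (Suc n)) = \<Delta> n" for n
  proof -
    have "p (Suc n) - p n = (2 * S n) *\<^sub>R Y n" for n
      unfolding step unfolding p by (simp flip: scaleR_left_distrib)
    then show ?thesis using signed_angle_scaleR[of "2 * S n" "2 * S (Suc n)"] S by (simp add: \<Delta>_def)
  qed
  then have "(\<lambda>N. (\<Sum>n<N. \<Delta> n) / (2 * pi) / real N) \<longlonglongrightarrow> 1/4"
    using rot by (simp add: has_rotation_number_def)
  from tendsto_mult[OF this tendsto_const[of "2 * pi"]]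
  have mean\<Delta>: "(\<lambda>N. (\<Sum>n<N. \<Delta> n) / real N) \<longlonglongrightarrow> pi / 2" by simp
  have one: "(\<lambda>N. real N / real N) \<longlonglongrightarrow> 1"
    by (rule tendsto_eventually) (auto intro: eventually_sequentiallyI[of 1])
  have "a / c - 1 \<ge> 0"
  proof (cases "\<exists>n0. S n0 \<le> 1")
    case False
    have "(\<lambda>N. (\<Sum>n<N. S n - 1) / real N) = (\<lambda>N. (\<Sum>n<N. S n) / real N - real N / real N)"
      by (simp add: sum_subtractf diff_divide_distrib)
    then have "(\<lambda>N. (\<Sum>n<N. S n - 1) / real N) \<longlonglongrightarrow> a / c - 1"
      using tendsto_diff[OF meanS one] by simp
    then show ?thesis
      by (rule mean_nonneg_if_eventually_nonneg[of _ _ 0]) (use False in \<open>auto simp: not_le less_imp_le\<close>)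
  next
    case True
    then obtain n0 where n0: "S n0 \<le> 1" by blast
    have eq: "X n + S n *\<^sub>R Y n = X (Suc n) - S (Suc n) *\<^sub>R Y (Suc n)" for n
      using step[of n] p[of "Suc n"] by simp
    have S1: "S n \<le> 1" if "n \<ge> n0" for n
      using that
    proof (induction n rule: dec_induct)
      case (step n)
      then show ?case using outer_billiard_step(1)[OF XY XY S S eq] by blast
    qed (rule n0)
    obtain R where R: "\<And>z. z \<in> closure \<Omega> \<Longrightarrow> norm z \<le> R"
      using compact_imp_bounded[OF compact_closure] by (auto simp: bounded_iff)
    define M where "M = R\<^sup>2 / c"
    define A where "A n = signed_angle (X n) (Y n)" for n
    \<comment> \<open>\<open>D\<close> is the slack in the turning estimate. Its mean is that of \<open>S n - 1\<close>: the turning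
      angles cancel \<open>\<pi>\<close> in the mean and the \<open>A\<close> terms telescope to something bounded.\<close>
    define D where "D n = S n - 1 + M * (pi - 2 * \<Delta> n + A (Suc n) - A n)" for n
    have D: "D n \<ge> 0" if "n \<ge> n0" for n
      using step_length_ge_turning[OF XY XY S S eq S1[OF that] R]
      unfolding cc D_def M_def \<Delta>_def A_def by linarith
    have "(\<Sum>n<N. D n) = (\<Sum>n<N. S n) - real N + M * (real N * pi - 2 * (\<Sum>n<N. \<Delta> n) + (A N - A 0))"
      for N
      by (induction N) (simp_all add: D_def algebra_simps)
    note sumD0 = this
    have sumD: "(\<lambda>N. (\<Sum>n<N. D n) / real N) = (\<lambda>N. (\<Sum>n<N. S n) / real N - real N / real N
        + M * (real N / real N * pi - 2 * ((\<Sum>n<N. \<Delta> n) / real N) + (A N - A 0) / real N))"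
    proof
      fix N
      show "(\<Sum>n<N. D n) / real N = (\<Sum>n<N. S n) / real N - real N / real N
        + M * (real N / real N * pi - 2 * ((\<Sum>n<N. \<Delta> n) / real N) + (A N - A 0) / real N)"
        unfolding sumD0 by (cases "N = 0") (simp_all add: field_simps)
    qed
    have An: "(\<lambda>N. (A N - A 0) / real N) \<longlonglongrightarrow> 0"
    proof (rule bounded_over_n_tendsto_0)
      show "\<bar>A n - A 0\<bar> \<le> 2 * pi" for n
        using abs_signed_angle_le[of "X n" "Y n"] abs_signed_angle_le[of "X 0" "Y 0"]
        by (simp add: A_def)
    qed
    have "(\<lambda>N. (\<Sum>n<N. D n) / real N) \<longlonglongrightarrow> a / c - 1 + M * (1 * pi - 2 * (pi / 2) + 0)"
      unfolding sumD by (intro tendsto_intros meanS one mean\<Delta> An)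
    from mean_nonneg_if_eventually_nonneg[OF this D] show ?thesis by simp
  qed
  then show ?thesis using c0 by (simp add: c_def field_simps)
qed

theorem beta_out_quarter:
  assumes "conjugate x y"
  shows "beta_out \<Omega> (1/4) = cross2 x y"
  unfolding beta_out_def
proof (rule cInf_eq_minimum)
  show "cross2 x y \<in> {a. \<exists>p. outer_orbit \<Omega> p \<and> has_rotation_number p (1/4) \<and> has_mean_action p a}"
    using quarter_orbit[OF assms] by simp
qed (use mean_action_ge[OF assms] in blast)

end

section \<open>The unit disk\<close>

definition unit_circle :: "real \<Rightarrow> plane" where
  "unit_circle t = vector [cos t, sin t]"

lemma unit_circle_nth [simp]: "unit_circle t $ 1 = cos t" "unit_circle t $ 2 = sin t"
  by (simp_all add: unit_circle_def)

lemma norm_unit_circle [simp]: "norm (unit_circle t) = 1"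
  by (simp add: norm_eq_sqrt_inner inner2 flip: power2_eq_square)

lemma unit_circle_derivative: "(unit_circle has_vector_derivative rot (unit_circle t)) (at t)"
  unfolding has_vector_derivative_def
proof (rule has_derivative_componentwise_within[THEN iffD2], rule ballI)
  fix i :: plane assume "i \<in> Basis"
  then consider "i = axis 1 1" | "i = axis 2 1"
    using exhaust_2 by (auto simp: Basis_vec_def) metis
  then show "((\<lambda>x. unit_circle x \<bullet> i) has_derivative (\<lambda>x. (x *\<^sub>R rot (unit_circle t)) \<bullet> i)) (at t)"
  proof cases
    case 1
    then show ?thesis
      by (auto simp: inner_axis intro!: derivative_eq_intros)
  next
    case 2
    then show ?thesis
      by (auto simp: inner_axis intro!: derivative_eq_intros)
  qed
qed

lemma bounded_linear_rot: "bounded_linear rot"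
  by (rule linear_conv_bounded_linear[THEN iffD1], rule linearI) (auto simp: vec2_eq_iff)

lemma C2_boundary_param_unit_circle:
  "C2_boundary_param (ball 0 1) unit_circle (\<lambda>t. rot (unit_circle t))
    (\<lambda>t. rot (rot (unit_circle t))) (2 * pi)"
proof -
  have inj: "inj_on unit_circle {0..<2*pi}"
  proof (rule inj_onI)
    fix s t assume st: "s \<in> {0..<2*pi}" "t \<in> {0..<2*pi}" and eq: "unit_circle s = unit_circle t"
    then have "cos s = cos t" "sin s = sin t" by (simp_all add: vec2_eq_iff)
    then have "sin s = sin t \<and> cos s = cos t" by simp
    then obtain n where n: "s = t + 2 * pi * real_of_int n" using sin_cos_eq_iff by metis
    then have "\<bar>2 * pi * real_of_int n\<bar> < 2 * pi * 1" using st by auto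
    then have "\<bar>real_of_int n\<bar> < 1" by (simp add: abs_mult)
    then show "s = t" using n by simp
  qed
  have im: "unit_circle ` {0..<2*pi} = frontier (ball 0 1)"
  proof
    show "frontier (ball 0 1) \<subseteq> unit_circle ` {0..<2*pi}"
    proof
      fix x :: plane assume "x \<in> frontier (ball 0 1)"
      then have "norm x = 1" by simp
      then have "(x $ 1)\<^sup>2 + (x $ 2)\<^sup>2 = 1"
        by (simp add: norm_eq_sqrt_inner inner2 flip: power2_eq_square)
      then obtain t where "0 \<le> t" "t < 2*pi" "x $ 1 = cos t" "x $ 2 = sin t"
        using sincos_total_2pi by metis
      then show "x \<in> unit_circle ` {0..<2*pi}"
        by (intro image_eqI[of _ _ t]) (auto simp: vec2_eq_iff)
    qed
  qed auto
  have nz: "rot (unit_circle t) \<noteq> 0" for t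
    using cross2_rot[of "unit_circle t"] by auto
  have curv: "cross2 (rot (unit_circle t)) (rot (rot (unit_circle t))) = (norm (rot (unit_circle t)))\<^sup>2" for t
    by (rule cross2_rot)
  show ?thesis
    unfolding C2_boundary_param_def
  proof (intro conjI allI)
    show "unit_circle (t + 2 * pi) = unit_circle t" for t by (simp add: vec2_eq_iff)
    show "(unit_circle has_vector_derivative rot (unit_circle t)) (at t)" for t
      by (rule unit_circle_derivative)
    show "((\<lambda>t. rot (unit_circle t)) has_vector_derivative rot (rot (unit_circle t))) (at t)" for t
      by (rule bounded_linear.has_vector_derivative[OF bounded_linear_rot unit_circle_derivative])
    have "continuous_on UNIV unit_circle"
      using unit_circle_derivative by (blast intro: continuous_at_imp_continuous_on has_vector_derivative_continuous)
    then show "continuous_on UNIV (\<lambda>t. rot (rot (unit_circle t)))"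
      using bounded_linear.continuous_on[OF bounded_linear_rot] by blast
    show "cross2 (rot (unit_circle t)) (rot (rot (unit_circle t))) / norm (rot (unit_circle t)) ^ 3 > 0" for t
      unfolding curv using nz by simp
  qed (use inj im nz in auto)
qed

lemma strictly_convex_unit_ball: "strictly_convex (ball (0::plane) 1)"
  unfolding strictly_convex_def
proof (intro ballI impI subsetI)
  fix x y z :: plane
  assume "x \<in> closure (ball 0 1)" "y \<in> closure (ball 0 1)" "x \<noteq> y" "z \<in> open_segment x y"
  then have "dist 0 z < 1"
    using dist_decreases_open_segment[of z x y 0] by auto
  then show "z \<in> interior (ball 0 1)" by simp
qed

lemma C2_convex_domain_unit_ball: "C2_convex_domain (ball 0 1)"
  unfolding C2_convex_domain_def
  using strictly_convex_unit_ball C2_boundary_param_unit_circle by fastforce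

interpretation unit_ball: C2_domain "ball 0 1"
  by unfold_locales (rule C2_convex_domain_unit_ball)

lemma supports_unit_ball:
  assumes "norm x = 1"
  shows "supports (ball 0 1) x v \<longleftrightarrow> (\<exists>k>0. v = k *\<^sub>R rot x)"
proof -
  have "x \<in> unit_circle ` {0..<2*pi}"
    using assms C2_boundary_param_unit_circle by (auto simp: C2_boundary_param_def)
  then obtain t where t: "x = unit_circle t" by blast
  show ?thesis
    using unit_ball.supports_velocity[OF C2_boundary_param_unit_circle, of t] supports_scaleR
    unfolding t by blast
qed

lemma radon_boundary_unit_ball: "radon_boundary (ball 0 1)"
  unfolding radon_boundary_def birkhoff_orthogonal_def
proof (intro conjI ballI impI)
  fix x y :: plane
  assume xy: "x \<in> frontier (ball 0 1)" "y \<in> frontier (ball 0 1)" "tangent_at (ball 0 1) x y"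
  then have n: "norm x = 1" "norm y = 1" by auto
  then have "y \<noteq> 0" by auto
  then have "supports (ball 0 1) x y \<or> supports (ball 0 1) x (- y)"
    using unit_ball.tangent_imp_supports xy(3) by blast
  then obtain k where k: "k > 0" "y = k *\<^sub>R rot x \<or> - y = k *\<^sub>R rot x"
    using supports_unit_ball[OF n(1)] by blast
  obtain t where t: "y = unit_circle t"
    using xy(2) C2_boundary_param_unit_circle unfolding C2_boundary_param_def by blast
  have rr: "rot (k *\<^sub>R rot x) = (- k) *\<^sub>R x" by (simp add: vec2_eq_iff)
  have rm: "rot (- y) = - rot y" by (simp add: vec2_eq_iff)
  have "rot y = (- k) *\<^sub>R x \<or> rot y = k *\<^sub>R x"
    using k(2) rr rm by (metis minus_minus scaleR_minus_left)
  then have "x = (- (1/k)) *\<^sub>R rot y \<or> x = (1/k) *\<^sub>R rot y" using k(1) by auto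
  then show "tangent_at (ball 0 1) y x"
    unfolding tangent_at_def using C2_boundary_param_unit_circle t by blast
qed auto

interpretation unit_ball: radon_domain "ball 0 1"
  by unfold_locales (rule radon_boundary_unit_ball)

lemma beta_out_unit_ball: "beta_out (ball 0 1) (1/4) = 1"
proof -
  let ?x = "unit_circle 0"
  have "unit_ball.conjugate ?x (rot ?x)"
    unfolding unit_ball.conjugate_def supports_unit_ball[OF norm_unit_circle]
    by (auto intro!: exI[of _ 1] simp: norm_eq_sqrt_inner inner2)
  then show ?thesis using unit_ball.beta_out_quarter cross2_rot[of ?x] by simp
qed

section \<open>Plane regions on which the area form is bounded\<close>

text \<open>Think of \<open>U t\<close> and \<open>V t\<close> as the heights of boundary points over the abscissas \<open>- cos t\<close> and
  \<open>sin t\<close>. The equality says that these two points span a parallelogram of the largest admissible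
  area. The solutions of the equality are \<open>U t = sin t + h t * cos t\<close>, \<open>V t = cos t - h t * sin t\<close>;
  in terms of \<open>h\<close> the inequality becomes \<open>sin s * cos t * (h t - h s) \<le> 1 - cos (s - t)\<close>, so \<open>h\<close> has
  increments of second order and is constant. A constant \<open>h\<close> shears the circle vertically, and the
  bound 1 on the heights leaves only \<open>h = 0\<close>.\<close>
lemma quarter_circle_rigidity:
  fixes U V :: "real \<Rightarrow> real"
  assumes le: "\<And>s t. s \<in> {0<..<pi/2} \<Longrightarrow> t \<in> {0<..<pi/2} \<Longrightarrow> sin s * U t + cos t * V s \<le> 1"
    and eq: "\<And>t. t \<in> {0<..<pi/2} \<Longrightarrow> sin t * U t + cos t * V t = 1"
    and le1: "\<And>t. t \<in> {0<..<pi/2} \<Longrightarrow> U t \<le> 1" "\<And>t. t \<in> {0<..<pi/2} \<Longrightarrow> V t \<le> 1"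
    and t: "t \<in> {0<..<pi/2}"
  shows "U t = sin t" "V t = cos t"
proof -
  define h where "h t = cos t * U t - sin t * V t" for t
  have sc: "sin t > 0" "cos t > 0" if "t \<in> {0<..<pi/2}" for t
    using that sin_gt_zero2 cos_gt_zero by auto
  have UV: "U t = sin t + h t * cos t" "V t = cos t - h t * sin t" if "t \<in> {0<..<pi/2}" for t
    using eq[OF that] sin_cos_squared_add[of t] unfolding h_def by algebra+
  have cos_bd: "1 - cos x \<le> x\<^sup>2 / 2" for x :: real
  proof -
    have "1 - cos x = 2 * (sin (x/2))\<^sup>2" using cos_double_sin[of "x/2"] by simp
    also have "\<dots> \<le> 2 * (x/2)\<^sup>2"
      using iffD1[OF abs_le_square_iff abs_sin_x_le_abs_x[of "x/2"]] by simp
    finally show ?thesis by (simp add: power2_eq_square)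
  qed
  have one_sided: "sin s * cos t * (h t - h s) \<le> (s - t)\<^sup>2 / 2"
    if "s \<in> {0<..<pi/2}" "t \<in> {0<..<pi/2}" for s t
  proof -
    have "sin s * cos t * (h t - h s) + cos (s - t) = sin s * U t + cos t * V s"
      unfolding UV[OF that(2)] UV[OF that(1)] by (simp add: cos_diff algebra_simps)
    then show ?thesis using le[OF that] cos_bd[of "s - t"] by linarith
  qed
  have const: "h s = h t" if st: "s \<in> {0<..<pi/2}" "t \<in> {0<..<pi/2}" for s t
  proof -
    \<comment> \<open>Away from the ends of the quarter turn, \<open>sin s * cos t\<close> is bounded below.\<close>
    define d where "d = min (min s t) (min (pi/2 - s) (pi/2 - t))"
    define I where "I = {d..pi/2 - d}"
    have "d \<le> s" by (simp add: d_def)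
    then have d: "0 < d" "d < pi/2" using st by (auto simp: d_def)
    have I: "I \<subseteq> {0<..<pi/2}" using d by (auto simp: I_def)
    define m where "m = (sin d)\<^sup>2"
    have sd: "sin d > 0" using d by (intro sin_gt_zero2) auto
    then have m: "m > 0" by (simp add: m_def)
    have scm: "sin x * cos y \<ge> m" if "x \<in> I" "y \<in> I" for x y
    proof -
      have "sin x \<ge> sin d" using that d by (intro sin_monotone_2pi_le) (auto simp: I_def)
      moreover have "cos y \<ge> sin d"
        using sin_monotone_2pi_le[of d "pi/2 - y"] that d by (auto simp: I_def sin_cos_eq)
      ultimately show ?thesis unfolding m_def power2_eq_square
        using sd by (intro mult_mono) auto
    qed
    have ub: "h y - h x \<le> 1 / (2 * m) * (x - y)\<^sup>2" if "x \<in> I" "y \<in> I" for x y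
    proof (cases "h y \<le> h x")
      case True
      have "0 \<le> 1 / (2 * m) * (x - y)\<^sup>2" using m by simp
      then show ?thesis using True by linarith
    next
      case False
      then have "m * (h y - h x) \<le> sin x * cos y * (h y - h x)"
        using scm[OF that] by (intro mult_right_mono) auto
      also have "\<dots> \<le> (x - y)\<^sup>2 / 2" using one_sided that I by blast
      finally show ?thesis using m by (simp add: field_simps)
    qed
    have "\<bar>h x - h y\<bar> \<le> 1 / (2 * m) * (x - y)\<^sup>2" if "x \<in> I" "y \<in> I" for x y
      using ub[OF that] ub[OF that(2) that(1)] unfolding power2_commute[of y x] by linarith
    then obtain c where "\<And>x. x \<in> I \<Longrightarrow> h x = c"
      using constant_if_quadratic_variation[of I h "1 / (2 * m)"] by (auto simp: I_def)
    moreover have "s \<in> I" "t \<in> I" by (auto simp: I_def d_def)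
    ultimately show ?thesis by simp
  qed
  \<comment> \<open>A nonzero constant would make one of the two arcs exceed height 1 near its upper.\<close>
  have "h t \<le> \<epsilon>" "- h t \<le> \<epsilon>" if \<epsilon>: "\<epsilon> > 0" for \<epsilon>
  proof -
    define r where "r = min \<epsilon> (pi/4)"
    have r: "r \<in> {0<..<pi/2}" "pi/2 - r \<in> {0<..<pi/2}" "r \<le> \<epsilon>" 
      using \<epsilon> pi_gt_zero by (auto simp: r_def min_def)
    have sr: "sin r \<le> r" using r by (intro sin_x_le_x) auto
    have "sin r > 0" "cos r > 0" using sc r by auto
    have s2: "1 - cos r \<le> (sin r)\<^sup>2"
    proof -
      have "cos r * cos r \<le> 1 * cos r" using \<open>cos r > 0\<close> by (intro mult_right_mono) auto
      then show ?thesis using sin_squared_eq[of r] by (simp add: power2_eq_square)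
    qed
    have "- h t * sin r \<le> 1 - cos r"
      using le1(2)[OF r(1)] UV(2)[OF r(1)] const[OF r(1) t] by simp
    then have "- h t * sin r \<le> sin r * sin r" using s2 by (simp add: power2_eq_square)
    then have "- h t \<le> sin r" using mult_right_le_imp_le[of "- h t" "sin r" "sin r"] \<open>sin r > 0\<close> by simp
    then show "- h t \<le> \<epsilon>" using sr r by linarith
    have "h t * sin r \<le> 1 - cos r"
      using le1(1)[OF r(2)] UV(1)[OF r(2)] const[OF r(2) t]
      by (simp add: sin_diff cos_diff)
    then have "h t * sin r \<le> sin r * sin r" using s2 by (simp add: power2_eq_square)
    then have "h t \<le> sin r" using \<open>sin r > 0\<close> by (simp add: mult_le_cancel_right)
    then show "h t \<le> \<epsilon>" using sr r by linarith
  qed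
  then have "h t \<le> 0" "- h t \<le> 0" using field_le_epsilon[of _ 0] by (metis add_0)+
  then have "h t = 0" by simp
  then show "U t = sin t" "V t = cos t" using UV[OF t] by simp_all
qed

text \<open>A convex body in the coordinates of a conjugate pair. Pairs of reals in place of plane vectors
  give direct access to iterated integrals.\<close>
locale area_form_bounded_body =
  fixes K :: "(real \<times> real) set"
  assumes opn: "open K" and conv: "convex K"
    and axis: "\<And>r. \<bar>r\<bar> < 1 \<Longrightarrow> (r, 0) \<in> K"
    and form: "\<And>a b a' b'. (a, b) \<in> K \<Longrightarrow> (a', b') \<in> K \<Longrightarrow> \<bar>a * b' - b * a'\<bar> \<le> 1"
    and box: "\<And>a b. (a, b) \<in> K \<Longrightarrow> \<bar>a\<bar> \<le> 1 \<and> \<bar>b\<bar> \<le> 1"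
begin

definition upper :: "real \<Rightarrow> real" where
  "upper u = Sup {b. (u, b) \<in> K}"

lemma bdd_above_slice: "bdd_above {b. (u, b) \<in> K}"
  using box by (intro bdd_aboveI[of _ 1]) fastforce

lemma le_upper: "(u, b) \<in> K \<Longrightarrow> b \<le> upper u"
  unfolding upper_def by (rule cSup_upper[OF _ bdd_above_slice]) simp

lemma less_upperE:
  assumes "\<bar>u\<bar> < 1" "r < upper u"
  obtains b where "(u, b) \<in> K" "r < b"
  using less_cSupE[of r "{b. (u, b) \<in> K}"] assms axis by (auto simp: upper_def)

lemma less_upper: 
  assumes "(u, b) \<in> K"
  shows "b < upper u"
proof -
  obtain e where e: "e > 0" "ball (u, b) e \<subseteq> K" using opn assms openE by blast
  have "(u, b + e/2) \<in> ball (u, b) e" using e(1) by (simp add: dist_Pair_Pair dist_real_def)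
  then show ?thesis using le_upper e by force
qed

lemma upper_le_1: "\<bar>u\<bar> < 1 \<Longrightarrow> upper u \<le> 1"
  unfolding upper_def using axis box by (intro cSup_least) fastforce+

text \<open>The bound on the area form passes to the boundary, where it need not be attained by points of
  the open set.\<close>
lemma upper_form:
  assumes "-1 < u" "u \<le> 0" "0 \<le> v" "v < 1"
  shows "v * upper u - u * upper v \<le> 1"
proof (rule field_le_epsilon)
  fix \<epsilon> :: real assume \<epsilon>: "\<epsilon> > 0"
  obtain b where b: "(u, b) \<in> K" "upper u - \<epsilon>/2 < b" using less_upperE[of u "upper u - \<epsilon>/2"] assms \<epsilon> by auto
  obtain b' where b': "(v, b') \<in> K" "upper v - \<epsilon>/2 < b'" using less_upperE[of v "upper v - \<epsilon>/2"] assms \<epsilon> by auto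
  have "v * (upper u - b) \<le> 1 * (\<epsilon>/2)" using assms b \<epsilon> le_upper[OF b(1)] by (intro mult_mono) auto
  moreover have "- u * (upper v - b') \<le> 1 * (\<epsilon>/2)" using assms b' \<epsilon> le_upper[OF b'(1)] by (intro mult_mono) auto
  moreover have "v * b - u * b' \<le> 1" using form[OF b(1) b'(1)] by (simp add: abs_le_iff mult.commute)
  ultimately show "v * upper u - u * upper v \<le> 1 + \<epsilon>" by (simp add: algebra_simps)
qed

text \<open>The upper boundary of a convex set is a concave function.\<close>
lemma continuous_on_upper: "continuous_on {-1<..<1} upper"
proof -
  have "convex_on {-1<..<1} (\<lambda>u. - upper u)"
  proof (rule convex_onI)
    fix t x y :: real
    assume t: "0 < t" "t < 1" and x: "x \<in> {-1<..<1}" and y: "y \<in> {-1<..<1}"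
    have "(1 - t) * upper x + t * upper y \<le> upper ((1 - t) * x + t * y)"
    proof (rule field_le_epsilon)
      fix \<epsilon> :: real assume \<epsilon>: "\<epsilon> > 0"
      have "\<bar>x\<bar> < 1" "\<bar>y\<bar> < 1" using x y by auto
      then obtain b b' where b: "(x, b) \<in> K" "upper x - \<epsilon> < b" and b': "(y, b') \<in> K" "upper y - \<epsilon> < b'"
        using less_upperE[of x "upper x - \<epsilon>"] less_upperE[of y "upper y - \<epsilon>"] \<epsilon> by (metis diff_less_eq less_add_same_cancel1)
      have "(1 - t) *\<^sub>R (x, b) + t *\<^sub>R (y, b') \<in> K"
        by (rule convexD_alt[OF conv b(1) b'(1)]) (use t in auto)
      then have "(1 - t) * b + t * b' \<le> upper ((1 - t) * x + t * y)" using le_upper by simp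
      moreover have "(1 - t) * (upper x - b) \<le> (1 - t) * \<epsilon>" "t * (upper y - b') \<le> t * \<epsilon>"
        using t b b' by (auto intro!: mult_left_mono)
      ultimately show "(1 - t) * upper x + t * upper y \<le> upper ((1 - t) * x + t * y) + \<epsilon>"
        by (simp add: algebra_simps)
    qed
    then show "- upper ((1 - t) *\<^sub>R x + t *\<^sub>R y) \<le> (1 - t) * - upper x + t * - upper y" by simp
  qed simp
  then have "continuous_on {-1<..<1} (\<lambda>u. - upper u)" by (rule convex_on_continuous[rotated]) simp
  from continuous_on_minus[OF this] show ?thesis by simp
qed

text \<open>Reflection in the first axis changes the sign of the area form only, so that facts about the
  upper boundary of the mirror image are facts about the lower boundary.\<close>
definition mirror :: "(real \<times> real) set" where
  "mirror = {(a, b). (a, - b) \<in> K}"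

lemma mirror_body: "area_form_bounded_body mirror"
proof
  have lin: "linear (\<lambda>(a, b). (a, - b :: real) :: real \<times> real)"
    by (rule linearI) (auto simp: algebra_simps)
  have eq: "mirror = (\<lambda>(a, b). (a, - b)) -` K" by (auto simp: mirror_def)
  show "convex mirror" unfolding eq using convex_linear_vimage[OF lin conv] .
  show "open mirror" unfolding eq
    by (rule open_vimage[OF opn]) (auto simp: case_prod_unfold intro!: continuous_intros)
next
  fix a b a' b' assume "(a, b) \<in> mirror" "(a', b') \<in> mirror"
  then show "\<bar>a * b' - b * a'\<bar> \<le> 1" using form[of a "- b" a' "- b'"] by (simp add: mirror_def)
qed (use axis box in \<open>fastforce simp: mirror_def\<close>)+


definition lower :: "real \<Rightarrow> real" where
  "lower = area_form_bounded_body.upper mirror"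

lemmas lower_facts =
  area_form_bounded_body.less_upper[OF mirror_body, folded lower_def]
  area_form_bounded_body.less_upperE[OF mirror_body, folded lower_def]
  area_form_bounded_body.upper_le_1[OF mirror_body, folded lower_def]
  area_form_bounded_body.upper_form[OF mirror_body, folded lower_def]
  area_form_bounded_body.continuous_on_upper[OF mirror_body, folded lower_def]

lemma slice_eq:
  assumes "\<bar>u\<bar> < 1"
  shows "{b. (u, b) \<in> K} = {- lower u<..<upper u}"
proof (intro set_eqI iffI)
  fix b assume "b \<in> {b. (u, b) \<in> K}"
  then show "b \<in> {- lower u<..<upper u}"
    using less_upper[of u b] lower_facts(1)[of u "- b"] by (auto simp: mirror_def)
next
  fix b assume b: "b \<in> {- lower u<..<upper u}"
  obtain b1 where b1: "(u, b1) \<in> K" "b < b1" using less_upperE[OF assms, of b] b by auto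
  obtain b2' where b2': "(u, b2') \<in> mirror" "- b < b2'" using lower_facts(2)[OF assms, of "- b"] b by auto
  define b2 where "b2 = - b2'"
  have b2: "(u, b2) \<in> K" "b2 < b" using b2' by (auto simp: mirror_def b2_def)
  define t where "t = (b - b2) / (b1 - b2)"
  have t: "0 \<le> t" "t \<le> 1" using b1 b2 by (auto simp: t_def field_simps)
  have "t * (b1 - b2) = b - b2" using b1 b2 by (simp add: t_def)
  then have "b = (1 - t) * b2 + t * b1" by (simp add: algebra_simps)
  then have "(u, b) = (1 - t) *\<^sub>R (u, b2) + t *\<^sub>R (u, b1)" by (simp add: algebra_simps)
  then show "b \<in> {b. (u, b) \<in> K}" using conv b1 b2 t unfolding convex_alt by (metis mem_Collect_eq)
qed

lemma slice_empty: "\<bar>u\<bar> > 1 \<Longrightarrow> {b. (u, b) \<in> K} = {}"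
  using box by fastforce

definition width :: "real \<Rightarrow> real" where
  "width u = measure lborel {b. (u, b) \<in> K}"

lemma width_eq:
  assumes "\<bar>u\<bar> < 1"
  shows "width u = upper u + lower u"
proof -
  have "0 \<in> {- lower u<..<upper u}" using axis[OF assms] unfolding slice_eq[OF assms, symmetric] by simp
  then show ?thesis unfolding width_def slice_eq[OF assms] by simp
qed

lemma width_nonneg: "width u \<ge> 0"
  by (simp add: width_def)

lemma slice_eq_vimage: "{b. (u, b) \<in> K} = Pair u -` K"
  by auto

lemma K_borel: "K \<in> sets (lborel \<Otimes>\<^sub>M lborel)"
  using opn unfolding lborel_prod by simp

lemma emeasure_slice: "emeasure lborel (Pair u -` K) = ennreal (width u)"
proof -
  have "bounded {b. (u, b) \<in> K}"
    using box by (intro boundedI[of _ 1]) auto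
  then have "emeasure lborel {b. (u, b) \<in> K} < \<infinity>" by (rule emeasure_bounded_finite)
  then show ?thesis unfolding width_def slice_eq_vimage[symmetric]
    by (simp add: emeasure_eq_ennreal_measure)
qed

lemma width_measurable [measurable]: "width \<in> borel_measurable borel"
proof -
  have "(\<lambda>u. emeasure lborel (Pair u -` K)) \<in> borel_measurable lborel"
    by (rule lborel.measurable_emeasure_Pair[OF K_borel])
  then have "(\<lambda>u. enn2real (ennreal (width u))) \<in> borel_measurable borel"
    unfolding emeasure_slice by simp
  then show ?thesis by (simp add: width_nonneg)
qed

definition paired_width :: "real \<Rightarrow> real" where
  "paired_width t = width (- cos t) * sin t + width (sin t) * cos t"

lemma paired_width_measurable [measurable]: "paired_width \<in> borel_measurable borel"
  unfolding paired_width_def[abs_def] by measurable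

text \<open>Substituting \<open>- cos t\<close> on the left half and \<open>sin t\<close> on the right half turns the area into an
  integral over the quarter turn that pairs two perpendicular slices.\<close>
lemma area_le_paired_integral:
  "emeasure lborel K \<le> (\<integral>\<^sup>+t. ennreal (paired_width t * indicator {0..pi/2} t) \<partial>lborel)"
proof -
  have wb: "set_borel_measurable borel A width" if "A \<in> sets borel" for A
    unfolding set_borel_measurable_def using that by measurable
  have "emeasure lborel K = emeasure (lborel \<Otimes>\<^sub>M lborel) K" by (simp add: lborel_prod)
  also have "\<dots> = (\<integral>\<^sup>+u. ennreal (width u) \<partial>lborel)"
    using lborel.emeasure_pair_measure_alt[OF K_borel] by (simp add: emeasure_slice)
  also have "\<dots> \<le> (\<integral>\<^sup>+u. ennreal (width u * indicator {-1..0} u) + ennreal (width u * indicator {0..1} u) \<partial>lborel)"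
  proof (rule nn_integral_mono)
    fix u :: real
    have "width u = 0" if "\<not> (- 1 \<le> u \<and> u \<le> 1)"
    proof -
      have "\<bar>u\<bar> > 1" using that by linarith
      then show ?thesis unfolding width_def using slice_empty by simp
    qed
    then show "ennreal (width u) \<le> ennreal (width u * indicator {-1..0} u) + ennreal (width u * indicator {0..1} u)"
      by (cases "- 1 \<le> u \<and> u \<le> 1") (auto simp: indicator_def)
  qed
  also have "\<dots> = (\<integral>\<^sup>+u. ennreal (width u * indicator {-1..0} u) \<partial>lborel)
      + (\<integral>\<^sup>+u. ennreal (width u * indicator {0..1} u) \<partial>lborel)"
    by (rule nn_integral_add) measurable
  also have "(\<integral>\<^sup>+u. ennreal (width u * indicator {-1..0} u) \<partial>lborel)
      = (\<integral>\<^sup>+t. ennreal (width (- cos t) * sin t * indicator {0..pi/2} t) \<partial>lborel)"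
  proof -
    have "(\<integral>\<^sup>+u. ennreal (width u * indicator {- cos 0..- cos (pi/2)} u) \<partial>lborel)
      = (\<integral>\<^sup>+t. ennreal (width (- cos t) * sin t * indicator {0..pi/2} t) \<partial>lborel)"
      by (rule nn_integral_substitution[OF wb])
        (auto intro!: derivative_eq_intros continuous_intros sin_ge_zero)
    then show ?thesis by simp
  qed
  also have "(\<integral>\<^sup>+u. ennreal (width u * indicator {0..1} u) \<partial>lborel)
      = (\<integral>\<^sup>+t. ennreal (width (sin t) * cos t * indicator {0..pi/2} t) \<partial>lborel)"
  proof -
    have "(\<integral>\<^sup>+u. ennreal (width u * indicator {sin 0..sin (pi/2)} u) \<partial>lborel)
      = (\<integral>\<^sup>+t. ennreal (width (sin t) * cos t * indicator {0..pi/2} t) \<partial>lborel)"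
      by (rule nn_integral_substitution[OF wb])
        (auto intro!: derivative_eq_intros continuous_intros cos_ge_zero)
    then show ?thesis by simp
  qed
  also have "(\<integral>\<^sup>+t. ennreal (width (- cos t) * sin t * indicator {0..pi/2} t) \<partial>lborel)
     + (\<integral>\<^sup>+t. ennreal (width (sin t) * cos t * indicator {0..pi/2} t) \<partial>lborel)
     = (\<integral>\<^sup>+t. ennreal (width (- cos t) * sin t * indicator {0..pi/2} t)
        + ennreal (width (sin t) * cos t * indicator {0..pi/2} t) \<partial>lborel)"
    by (rule nn_integral_add[symmetric]) measurable
  also have "\<dots> = (\<integral>\<^sup>+t. ennreal (paired_width t * indicator {0..pi/2} t) \<partial>lborel)"
  proof (rule nn_integral_cong)
    fix t :: real
    show "ennreal (width (- cos t) * sin t * indicator {0..pi/2} t)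
        + ennreal (width (sin t) * cos t * indicator {0..pi/2} t)
        = ennreal (paired_width t * indicator {0..pi/2} t)"
      by (cases "t \<in> {0..pi/2}")
        (auto simp: paired_width_def width_nonneg sin_ge_zero cos_ge_zero simp flip: ennreal_plus)
  qed
  finally show ?thesis .
qed

lemma cos_sin_range:
  assumes "t \<in> {0<..<pi/2}"
  shows "0 < sin t" "sin t < 1" "0 < cos t" "cos t < 1"
proof -
  show s: "0 < sin t" and c: "0 < cos t" using assms sin_gt_zero2 cos_gt_zero by auto
  have "(sin t)\<^sup>2 + (cos t)\<^sup>2 = 1" by simp
  moreover have "(sin t)\<^sup>2 > 0" "(cos t)\<^sup>2 > 0" using s c by auto
  ultimately have "(sin t)\<^sup>2 < 1" "(cos t)\<^sup>2 < 1" by linarith+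
  then show "sin t < 1" "cos t < 1" by (auto simp: abs_square_less_1)
qed

lemma paired_width_eq:
  assumes "t \<in> {0<..<pi/2}"
  shows "paired_width t = (sin t * upper (- cos t) + cos t * upper (sin t))
    + (sin t * lower (- cos t) + cos t * lower (sin t))"
  using cos_sin_range[OF assms] by (simp add: paired_width_def width_eq algebra_simps)

text \<open>The boundary points over \<open>- cos t\<close> and \<open>sin s\<close> on one side of the axis span a parallelogram of
  area at most 1.\<close>
lemma paired_upper_le:
  assumes "s \<in> {0<..<pi/2}" "t \<in> {0<..<pi/2}"
  shows "sin s * upper (- cos t) + cos t * upper (sin s) \<le> 1"
    and "sin s * lower (- cos t) + cos t * lower (sin s) \<le> 1"
  using cos_sin_range[OF assms(1)] cos_sin_range[OF assms(2)]
    upper_form[of "- cos t" "sin s"] lower_facts(4)[of "- cos t" "sin s"] by auto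

lemma paired_width_le_2:
  assumes "t \<in> {0..pi/2}"
  shows "paired_width t \<le> 2"
proof -
  have w0: "width 0 \<le> 2" using width_eq[of 0] upper_le_1[of 0] lower_facts(3)[of 0] by simp
  consider "t = 0" | "t = pi/2" | "t \<in> {0<..<pi/2}" using assms by force
  then show ?thesis
  proof cases
    case 1
    then show ?thesis using w0 by (simp add: paired_width_def)
  next
    case 2
    show ?thesis unfolding 2 using w0 by (simp add: paired_width_def)
  next
    case 3
    then show ?thesis using paired_width_eq[OF 3] paired_upper_le[OF 3 3] by simp
  qed
qed

lemma integral_const_quarter:
  "(\<integral>\<^sup>+t. ennreal (2 * indicator {0..pi/2} t) \<partial>lborel) = ennreal pi"
proof -
  have "(\<integral>\<^sup>+t. ennreal (2 * indicator {0..pi/2} t) \<partial>lborel)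
      = (\<integral>\<^sup>+t. ennreal 2 * indicator {0..pi/2} t \<partial>lborel)"
    by (intro nn_integral_cong) (auto simp: indicator_def)
  also have "\<dots> = ennreal 2 * emeasure lborel {0..pi/2}"
    by (rule nn_integral_cmult_indicator) simp
  also have "\<dots> = ennreal 2 * ennreal (pi/2)" by simp
  also have "\<dots> = ennreal (2 * (pi/2))" by (rule ennreal_mult[symmetric]) auto
  also have "\<dots> = ennreal pi" by simp
  finally show ?thesis .
qed

text \<open>The paired widths are at most 2 on an interval of length \<open>\<pi>/2\<close>.\<close>
lemma area_le_pi: "emeasure lborel K \<le> ennreal pi"
proof -
  have "(\<integral>\<^sup>+t. ennreal (paired_width t * indicator {0..pi/2} t) \<partial>lborel)
      \<le> (\<integral>\<^sup>+t. ennreal (2 * indicator {0..pi/2} t) \<partial>lborel)"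
    using paired_width_le_2 by (intro nn_integral_mono ennreal_leI) (auto simp: indicator_def)
  then show ?thesis using area_le_paired_integral integral_const_quarter by simp
qed

lemma continuous_on_paired_width: "continuous_on {0<..<pi/2} paired_width"
proof -
  have "continuous_on {0<..<pi/2} (\<lambda>t. (sin t * upper (- cos t) + cos t * upper (sin t))
    + (sin t * lower (- cos t) + cos t * lower (sin t)))"
    by (intro continuous_intros continuous_on_compose2[OF continuous_on_upper]
        continuous_on_compose2[OF lower_facts(5)]) (use cos_sin_range in fastforce)+
  then show ?thesis by (rule continuous_on_eq) (simp add: paired_width_eq)
qed

text \<open>By continuity, a deficit at one point would persist on an interval and be visible in the
  area.\<close>
lemma paired_width_eq_2_if_area_eq_pi:
  assumes area: "emeasure lborel K = ennreal pi" and t: "t \<in> {0<..<pi/2}"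
  shows "paired_width t = 2"
proof (rule ccontr)
  assume "paired_width t \<noteq> 2"
  then have less: "paired_width t < 2" using paired_width_le_2[of t] t by auto
  define \<epsilon> where "\<epsilon> = (2 - paired_width t) / 2"
  have \<epsilon>: "\<epsilon> > 0" using less by (simp add: \<epsilon>_def)
  have "isCont paired_width t"
    using continuous_on_paired_width t by (simp add: continuous_on_eq_continuous_at)
  then obtain d where d: "d > 0" "\<And>x. \<bar>x - t\<bar> < d \<Longrightarrow> \<bar>paired_width x - paired_width t\<bar> < \<epsilon>"
    using \<epsilon> unfolding continuous_at_eps_delta dist_real_def by blast
  define p q where "p = max 0 (t - d)" and "q = min (pi/2) (t + d)"
  have pq: "p < q" "{p<..<q} \<subseteq> {0..pi/2}" using t d(1) by (auto simp: p_def q_def max_def min_def)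
  have small: "paired_width x + \<epsilon> \<le> 2" if x: "x \<in> {p<..<q}" for x
  proof -
    have "\<bar>x - t\<bar> < d" using x by (auto simp: p_def q_def)
    from d(2)[OF this] have "paired_width x < paired_width t + \<epsilon>" by linarith
    then show ?thesis unfolding \<epsilon>_def by (simp add: field_simps)
  qed
  have "ennreal pi + ennreal \<epsilon> * ennreal (q - p)
      \<le> (\<integral>\<^sup>+x. ennreal (paired_width x * indicator {0..pi/2} x) \<partial>lborel)
        + (\<integral>\<^sup>+x. ennreal \<epsilon> * indicator {p<..<q} x \<partial>lborel)"
    using area area_le_paired_integral pq by (intro add_mono) (simp_all add: nn_integral_cmult_indicator)
  also have "\<dots> = (\<integral>\<^sup>+x. ennreal (paired_width x * indicator {0..pi/2} x)
        + ennreal \<epsilon> * indicator {p<..<q} x \<partial>lborel)"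
    by (rule nn_integral_add[symmetric]) measurable
  also have "\<dots> \<le> (\<integral>\<^sup>+x. ennreal (2 * indicator {0..pi/2} x) \<partial>lborel)"
  proof (rule nn_integral_mono)
    fix x :: real
    show "ennreal (paired_width x * indicator {0..pi/2} x) + ennreal \<epsilon> * indicator {p<..<q} x
        \<le> ennreal (2 * indicator {0..pi/2} x)"
    proof (cases "x \<in> {p<..<q}")
      case True
      then have x: "x \<in> {0..pi/2}" using pq by blast
      have "paired_width x \<ge> 0"
        using x by (auto simp: paired_width_def width_nonneg sin_ge_zero cos_ge_zero)
      then have "ennreal (paired_width x) + ennreal \<epsilon> = ennreal (paired_width x + \<epsilon>)"
        using \<epsilon> by (simp add: ennreal_plus)
      also have "\<dots> \<le> ennreal 2" using small[OF True] by (rule ennreal_leI)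
      finally show ?thesis using True x by simp
    next
      case False
      then show ?thesis using ennreal_leI[OF paired_width_le_2[of x]] by (auto simp: indicator_def)
    qed
  qed
  also have "\<dots> = ennreal pi" by (rule integral_const_quarter)
  finally have "ennreal (pi + \<epsilon> * (q - p)) \<le> ennreal pi"
    using \<epsilon> pq by (simp add: ennreal_plus ennreal_mult)
  then have "\<epsilon> * (q - p) \<le> 0" by (simp add: ennreal_le_iff)
  moreover have "\<epsilon> * (q - p) > 0" using \<epsilon> pq by simp
  ultimately show False by linarith
qed

lemma eq_disk_if_area_eq_pi:
  assumes area: "emeasure lborel K = ennreal pi"
  shows "K = {(a, b). a\<^sup>2 + b\<^sup>2 < 1}"
proof -
  have eq: "sin t * upper (- cos t) + cos t * upper (sin t) = 1"
    "sin t * lower (- cos t) + cos t * lower (sin t) = 1" if t: "t \<in> {0<..<pi/2}" for t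
    using paired_upper_le[OF t t] paired_width_eq[OF t] paired_width_eq_2_if_area_eq_pi[OF area t]
    by linarith+
  have bd: "upper (- cos t) \<le> 1" "upper (sin t) \<le> 1" "lower (- cos t) \<le> 1" "lower (sin t) \<le> 1"
    if t: "t \<in> {0<..<pi/2}" for t
    using cos_sin_range[OF t] by (auto intro!: upper_le_1 lower_facts(3))
  have U: "upper (- cos t) = sin t" "upper (sin t) = cos t" if t: "t \<in> {0<..<pi/2}" for t
    using quarter_circle_rigidity[of "\<lambda>t. upper (- cos t)" "\<lambda>t. upper (sin t)" t]
      paired_upper_le(1) eq(1) bd t by auto
  have L: "lower (- cos t) = sin t" "lower (sin t) = cos t" if t: "t \<in> {0<..<pi/2}" for t
    using quarter_circle_rigidity[of "\<lambda>t. lower (- cos t)" "\<lambda>t. lower (sin t)" t]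
      paired_upper_le(2) eq(2) bd t by auto
  \<comment> \<open>The parametrization by \<open>t\<close> misses the abscissa 0, which continuity supplies.\<close>
  have circle: "f u = sqrt (1 - u\<^sup>2)" if u: "\<bar>u\<bar> < 1" and cont: "continuous_on {-1<..<1} f"
    and f: "\<And>t. t \<in> {0<..<pi/2} \<Longrightarrow> f (- cos t) = sin t"
      "\<And>t. t \<in> {0<..<pi/2} \<Longrightarrow> f (sin t) = cos t" for f :: "real \<Rightarrow> real" and u
  proof -
    have *: "f u = sqrt (1 - u\<^sup>2)" if u: "\<bar>u\<bar> < 1" "u \<noteq> 0" for u
    proof (cases "u > 0")
      case True
      define t where "t = arcsin u"
      have t: "t \<in> {0<..<pi/2}" "sin t = u"
        using arcsin_less_arcsin[of 0 u] arcsin_less_arcsin[of u 1] True u by (auto simp: t_def)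
      then show ?thesis using f(2)[OF t(1)] cos_sin_range[OF t(1)] by (simp add: cos_squared_eq real_sqrt_unique flip: t(2))
          (metis abs_of_pos cos_squared_eq real_sqrt_abs)
    next
      case False
      define t where "t = arccos (- u)"
      have t: "t \<in> {0<..<pi/2}" "- cos t = u"
        using arccos_less_arccos[of 0 "- u"] arccos_less_arccos[of "- u" 1] False u by (auto simp: t_def)
      have "sqrt (1 - u\<^sup>2) = sin t" using cos_sin_range[OF t(1)] t(2)
        by (metis abs_of_pos power2_minus real_sqrt_abs sin_squared_eq)
      then show ?thesis using f(1)[OF t(1)] t(2) by simp
    qed
    show ?thesis
    proof (cases "u = 0")
      case True
      have "isCont f 0" using cont by (simp add: continuous_on_eq_continuous_at)
      then have "(f \<longlongrightarrow> f 0) (at 0)" by (simp add: isCont_def)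
      moreover have "\<forall>\<^sub>F x in at 0. f x = sqrt (1 - x\<^sup>2)"
        unfolding eventually_at using * by (intro exI[of _ 1]) auto
      ultimately have "((\<lambda>x. sqrt (1 - x\<^sup>2)) \<longlongrightarrow> f 0) (at 0)"
        by (simp add: tendsto_cong)
      moreover have "((\<lambda>x::real. sqrt (1 - x\<^sup>2)) \<longlongrightarrow> sqrt (1 - 0\<^sup>2)) (at 0)"
        by (intro tendsto_intros)
      ultimately show ?thesis using True tendsto_unique[OF at_neq_bot] by blast
    qed (use * u in auto)
  qed
  have slice: "(a, b) \<in> K \<longleftrightarrow> a\<^sup>2 + b\<^sup>2 < 1" if a: "\<bar>a\<bar> < 1" for a b
  proof -
    have "(a, b) \<in> K \<longleftrightarrow> b \<in> {- lower a<..<upper a}" using slice_eq[OF a] by blast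
    also have "\<dots> \<longleftrightarrow> \<bar>b\<bar> < sqrt (1 - a\<^sup>2)"
      using circle[OF a continuous_on_upper U] circle[OF a lower_facts(5) L] by auto
    also have "\<dots> \<longleftrightarrow> b\<^sup>2 < 1 - a\<^sup>2"
      using real_sqrt_less_iff[of "b\<^sup>2" "1 - a\<^sup>2"] by simp
    finally show ?thesis by auto
  qed
  have strict: "\<bar>a\<bar> < 1" if ab: "(a, b) \<in> K" for a b
  proof -
    obtain e where e: "e > 0" "ball (a, b) e \<subseteq> K" using opn ab openE by blast
    have "(a + e/2, b) \<in> ball (a, b) e" "(a - e/2, b) \<in> ball (a, b) e"
      using e(1) by (simp_all add: dist_Pair_Pair dist_real_def)
    then have "\<bar>a + e/2\<bar> \<le> 1" "\<bar>a - e/2\<bar> \<le> 1" using box e(2) by blast+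
    then show ?thesis using e(1) by linarith
  qed
  have "\<bar>a\<bar> < 1" if "a\<^sup>2 + b\<^sup>2 < 1" for a b :: real
    using that abs_square_less_1[of a] zero_le_power2[of b] by linarith
  then have "(a, b) \<in> K \<longleftrightarrow> a\<^sup>2 + b\<^sup>2 < 1" for a b using slice strict by blast
  then show ?thesis by auto
qed

end

section \<open>Area in oblique coordinates\<close>

lemma Basis_plane: "(Basis :: plane set) = {axis 1 1, axis 2 1}"
  by (auto simp: Basis_vec_def UNIV_2)

lemma vector2_measurable: "(\<lambda>(a, b). vector [a, b] :: plane) \<in> borel_measurable borel"
proof (rule borel_measurable_continuous_onI)
  have "(\<lambda>(a, b). vector [a, b] :: plane) = (\<lambda>p. fst p *\<^sub>R vector [1, 0] + snd p *\<^sub>R vector [0, 1])"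
    by (auto simp: vec2_eq_iff)
  then show "continuous_on UNIV (\<lambda>(a, b). vector [a, b] :: plane)"
    by (auto intro!: continuous_intros)
qed

lemma lborel_plane_eq: "(lborel :: plane measure) = distr lborel borel (\<lambda>(a, b). vector [a, b])"
proof (rule lborel_eqI)
  fix l u :: plane assume le: "\<And>b. b \<in> Basis \<Longrightarrow> l \<bullet> b \<le> u \<bullet> b"
  have le12: "l $ 1 \<le> u $ 1" "l $ 2 \<le> u $ 2"
    using le[of "axis 1 1"] le[of "axis 2 1"] by (auto simp: Basis_plane inner_axis)
  have vim: "(\<lambda>(a, b). vector [a, b] :: plane) -` box l u = {l $ 1<..<u $ 1} \<times> {l $ 2<..<u $ 2}"
    by (auto simp: mem_box Basis_plane inner_axis)
  have "emeasure (distr lborel borel (\<lambda>(a, b). vector [a, b])) (box l u)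
      = emeasure (lborel \<Otimes>\<^sub>M lborel) ({l $ 1<..<u $ 1} \<times> {l $ 2<..<u $ 2})"
    using vector2_measurable by (simp add: emeasure_distr vim lborel_prod)
  also have "\<dots> = ennreal (u $ 1 - l $ 1) * ennreal (u $ 2 - l $ 2)"
    using le12 by (simp add: lborel.emeasure_pair_measure_Times)
  also have "\<dots> = ennreal ((u $ 1 - l $ 1) * (u $ 2 - l $ 2))"
    using le12 by (simp add: ennreal_mult)
  also have "(u $ 1 - l $ 1) * (u $ 2 - l $ 2) = (\<Prod>b\<in>Basis. (u - l) \<bullet> b)"
    by (simp add: Basis_plane inner_axis axis_eq_axis inner_diff_left)
  finally show "emeasure (distr lborel borel (\<lambda>(a, b). vector [a, b])) (box l u)
      = ennreal (\<Prod>b\<in>Basis. (u - l) \<bullet> b)" .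
qed simp

lemma measure_plane_eq:
  fixes S :: "plane set"
  assumes "open S"
  shows "measure lebesgue S = measure lborel {(a, b). vector [a, b] \<in> S}"
proof -
  have meas: "(\<lambda>(a, b). vector [a, b] :: plane) \<in> borel_measurable lborel"
    using vector2_measurable by simp
  have "measure lebesgue S = measure lborel S" using assms by (simp add: measure_completion)
  also have "\<dots> = measure (distr lborel borel (\<lambda>(a, b). vector [a, b])) S"
    by (subst lborel_plane_eq) simp
  also have "\<dots> = measure lborel ((\<lambda>(a, b). vector [a, b] :: plane) -` S)"
    using assms by (subst measure_distr[OF meas]) auto
  also have "(\<lambda>(a, b). vector [a, b] :: plane) -` S = {(a, b). vector [a, b] \<in> S}" by auto
  finally show ?thesis .
qed

lemma oblique_coordinates:
  assumes "cross2 x y \<noteq> 0"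
  shows "w = (cross2 w y / cross2 x y) *\<^sub>R x + (cross2 x w / cross2 x y) *\<^sub>R y"
proof -
  have "w = (1 / cross2 x y) *\<^sub>R (cross2 x y *\<^sub>R w)" using assms by simp
  also have "\<dots> = (cross2 w y / cross2 x y) *\<^sub>R x + (cross2 x w / cross2 x y) *\<^sub>R y"
    unfolding cross2_cramer[of x y w] by (simp add: scaleR_add_right)
  finally show ?thesis .
qed

lemma measure_oblique_coordinates:
  fixes S :: "plane set"
  assumes S: "open S" "bounded S" and xy: "cross2 x y \<noteq> 0"
  shows "measure lebesgue S = \<bar>cross2 x y\<bar> * measure lborel {(a, b). a *\<^sub>R x + b *\<^sub>R y \<in> S}"
proof -
  define c where "c = cross2 x y"
  \<comment> \<open>\<open>M\<close> takes a vector to its coordinates with respect to \<open>x\<close> and \<open>y\<close>.\<close>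
  define M :: "plane \<Rightarrow> plane" where "M w = vector [cross2 w y / c, cross2 x w / c]" for w
  have M: "M w $ 1 = cross2 w y / c" "M w $ 2 = cross2 x w / c" for w
    by (simp_all add: M_def)
  have lin: "linear M"
    by (rule linearI) (simp_all add: vec2_eq_iff M cross2_add add_divide_distrib)
  have inv: "M (a *\<^sub>R x + b *\<^sub>R y) = vector [a, b]" for a b
    using xy by (simp add: vec2_eq_iff M cross2_add c_def)
  have "det (matrix M) = (x $ 1 * y $ 2 - x $ 2 * y $ 1) / (c * c)"
    unfolding det_2 by (simp add: matrix_def M cross2_def axis_def diff_divide_distrib mult.commute)
  then have det: "det (matrix M) = 1 / c" using xy by (simp add: c_def cross2_def)
  have img: "M ` S = {z :: plane. z $ 1 *\<^sub>R x + z $ 2 *\<^sub>R y \<in> S}"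
  proof (intro set_eqI iffI)
    fix z assume "z \<in> M ` S"
    then obtain w where w: "w \<in> S" "z = M w" by blast
    then have "z $ 1 *\<^sub>R x + z $ 2 *\<^sub>R y = w"
      using oblique_coordinates[OF xy, of w, symmetric] by (simp add: M c_def)
    then show "z \<in> {z. z $ 1 *\<^sub>R x + z $ 2 *\<^sub>R y \<in> S}" using w by simp
  next
    fix z :: plane assume z: "z \<in> {z. z $ 1 *\<^sub>R x + z $ 2 *\<^sub>R y \<in> S}"
    have "z = M (z $ 1 *\<^sub>R x + z $ 2 *\<^sub>R y)" unfolding inv by (simp add: vec2_eq_iff)
    then show "z \<in> M ` S" using z by blast
  qed
  have op: "open (M ` S)" unfolding img
    by (rule open_vimage[OF S(1), of "\<lambda>z :: plane. z $ 1 *\<^sub>R x + z $ 2 *\<^sub>R y", unfolded vimage_def])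
      (intro continuous_intros)
  have "S \<in> lmeasurable" using S by (intro bounded_set_imp_lmeasurable) auto
  then have "measure lebesgue (M ` S) = \<bar>1 / c\<bar> * measure lebesgue S"
    using measure_linear_image[OF lin] det by simp
  moreover have "measure lebesgue (M ` S) = measure lborel {(a, b). a *\<^sub>R x + b *\<^sub>R y \<in> S}"
    unfolding measure_plane_eq[OF op] unfolding img by simp
  ultimately show ?thesis using xy by (simp add: c_def field_simps)
qed

lemma measure_unit_disk_prod: "measure lborel {(a, b). a\<^sup>2 + b\<^sup>2 < (1::real)} = pi"
proof -
  have "{(a, b). a\<^sup>2 + b\<^sup>2 < (1::real)} = ball (0 :: real \<times> real) 1"
    by (auto simp: dist_norm norm_Pair)
  then show ?thesis using content_ball[of 1 "0 :: real \<times> real"] by (simp add: unit_ball_vol_2)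
qed

section \<open>Ellipses\<close>

lemma orthonormal_expansion:
  assumes "norm u = 1" "norm v = 1" "u \<bullet> v = 0"
  shows "(w::plane) = (w \<bullet> u) *\<^sub>R u + (w \<bullet> v) *\<^sub>R v" and "\<bar>cross2 u v\<bar> = 1"
proof -
  have "(cross2 u v)\<^sup>2 = 1" using lagrange_cross2[of u v] assms by simp
  then show c: "\<bar>cross2 u v\<bar> = 1" by (auto simp: power2_eq_1_iff)
  then have "cross2 u v \<noteq> 0" by auto
  from oblique_coordinates[OF this] obtain a b where w: "w = a *\<^sub>R u + b *\<^sub>R v" by blast
  have "u \<bullet> u = 1" "v \<bullet> v = 1" using assms by (auto simp: norm_eq_1)
  then have "w \<bullet> u = a" "w \<bullet> v = b"
    using assms(3) by (simp_all add: w inner_add_left inner_commute[of v u])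
  then show "w = (w \<bullet> u) *\<^sub>R u + (w \<bullet> v) *\<^sub>R v" using w by simp
qed

text \<open>A pair of conjugate semi-diameters can be rotated through the elliptical motion into an
  orthogonal pair, because their inner product changes sign after a quarter turn.\<close>
lemma is_ellipse_if_conjugate_diameters:
  assumes xy: "cross2 x y \<noteq> 0" and \<Omega>: "\<And>a b. a *\<^sub>R x + b *\<^sub>R y \<in> \<Omega> \<longleftrightarrow> a\<^sup>2 + b\<^sup>2 < 1"
  shows "is_ellipse \<Omega>"
proof -
  define X Y where "X \<theta> = cos \<theta> *\<^sub>R x + sin \<theta> *\<^sub>R y" and "Y \<theta> = cos \<theta> *\<^sub>R y - sin \<theta> *\<^sub>R x" for \<theta>
  define g where "g \<theta> = X \<theta> \<bullet> Y \<theta>" for \<theta>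
  have cont: "continuous_on {0..pi/2} g"
    unfolding g_def X_def Y_def by (intro continuous_intros)
  have g: "g (pi/2) = - g 0" by (simp add: g_def X_def Y_def inner_commute)
  have "\<exists>\<theta>. g \<theta> = 0"
  proof (cases "g 0 \<le> 0")
    case True
    then show ?thesis using IVT'[of g 0 0 "pi/2"] g cont by auto
  next
    case False
    then show ?thesis using IVT2'[of g "pi/2" 0 0] g cont by auto
  qed
  then obtain \<theta> where \<theta>: "g \<theta> = 0" by blast
  have sc: "(cos \<theta>)\<^sup>2 + (sin \<theta>)\<^sup>2 = 1" by simp
  have "cross2 (X \<theta>) (Y \<theta>) = (cos \<theta>)\<^sup>2 * cross2 x y + (sin \<theta>)\<^sup>2 * cross2 x y"
    by (simp add: X_def Y_def cross2_add cross2_skew[of y x] power2_eq_square algebra_simps)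
  also have "\<dots> = cross2 x y" unfolding distrib_right[symmetric] sc by simp
  finally have XY: "cross2 (X \<theta>) (Y \<theta>) \<noteq> 0" using xy by simp
  then have nz: "norm (X \<theta>) > 0" "norm (Y \<theta>) > 0" by auto
  have mem: "a *\<^sub>R X \<theta> + b *\<^sub>R Y \<theta> \<in> \<Omega> \<longleftrightarrow> a\<^sup>2 + b\<^sup>2 < 1" for a b
  proof -
    have "a *\<^sub>R X \<theta> + b *\<^sub>R Y \<theta> = (a * cos \<theta> - b * sin \<theta>) *\<^sub>R x + (a * sin \<theta> + b * cos \<theta>) *\<^sub>R y"
      by (simp add: X_def Y_def algebra_simps)
    moreover have "(a * cos \<theta> - b * sin \<theta>)\<^sup>2 + (a * sin \<theta> + b * cos \<theta>)\<^sup>2 = a\<^sup>2 + b\<^sup>2"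
      using sc by algebra
    ultimately show ?thesis using \<Omega> by simp
  qed
  define u v where "u = (1 / norm (X \<theta>)) *\<^sub>R X \<theta>" and "v = (1 / norm (Y \<theta>)) *\<^sub>R Y \<theta>"
  have uv: "norm u = 1" "norm v = 1" "u \<bullet> v = 0"
    using nz \<theta> by (simp_all add: u_def v_def g_def)
  have "w \<in> \<Omega> \<longleftrightarrow> ((w - 0) \<bullet> u / norm (X \<theta>))\<^sup>2 + ((w - 0) \<bullet> v / norm (Y \<theta>))\<^sup>2 < 1" for w
  proof -
    define a b where "a = w \<bullet> u / norm (X \<theta>)" and "b = w \<bullet> v / norm (Y \<theta>)"
    have "a *\<^sub>R X \<theta> + b *\<^sub>R Y \<theta> = (w \<bullet> u) *\<^sub>R u + (w \<bullet> v) *\<^sub>R v"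
      by (simp add: a_def b_def u_def v_def)
    also have "\<dots> = w" by (rule orthonormal_expansion(1)[OF uv, symmetric])
    finally show ?thesis using mem[of a b] by (simp add: a_def b_def)
  qed
  then show ?thesis unfolding is_ellipse_def using uv nz by blast
qed

context radon_domain
begin

lemma minus_in: 
  assumes "z \<in> \<Omega>"
  shows "- z \<in> \<Omega>"
proof (cases "z = 0")
  case False
  then obtain d where d: "d > 0" "d *\<^sub>R z \<in> frontier \<Omega>" using normalize_to_frontier by blast
  have "d *\<^sub>R z \<notin> \<Omega>" using d frontier_eq by blast
  then have "\<not> d < 1" "d \<noteq> 1"
    using scaled_in[of z d] assms d closure_subset[of \<Omega>] by auto
  then have "1 / d < 1" by simp
  then have "(1 / d) *\<^sub>R - (d *\<^sub>R z) \<in> \<Omega>"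
    by (intro scaled_in frontier_subset_closure frontier_minus d(2)) (use d(1) in auto)
  then show ?thesis using d(1) by simp
qed (use assms in simp)

text \<open>In the coordinates of a conjugate pair, the domain satisfies the normalization under which its
  area is at most \<open>\<pi>\<close>.\<close>
lemma conjugate_coordinates_body:
  assumes xy: "conjugate x y"
  shows "area_form_bounded_body {(a, b). a *\<^sub>R x + b *\<^sub>R y \<in> \<Omega>}"
proof
  let ?L = "\<lambda>p::real \<times> real. fst p *\<^sub>R x + snd p *\<^sub>R y"
  have eq: "{(a, b). a *\<^sub>R x + b *\<^sub>R y \<in> \<Omega>} = ?L -` \<Omega>" by auto
  have lin: "linear ?L" by (rule linearI) (auto simp: algebra_simps)
  show "open {(a, b). a *\<^sub>R x + b *\<^sub>R y \<in> \<Omega>}"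
    unfolding eq by (rule open_vimage[OF opn]) (intro continuous_intros)
  show "convex {(a, b). a *\<^sub>R x + b *\<^sub>R y \<in> \<Omega>}"
    unfolding eq by (rule convex_linear_vimage[OF lin conv])
  note fr = conj_frontier[OF xy]
  note c0 = conj_pos[OF xy]
  note bnd = abs_cross2_le_conj[OF xy]
  show "(r, 0) \<in> {(a, b). a *\<^sub>R x + b *\<^sub>R y \<in> \<Omega>}" if "\<bar>r\<bar> < 1" for r
  proof -
    have "\<bar>r\<bar> *\<^sub>R x \<in> \<Omega>" using scaled_in[OF frontier_subset_closure[OF fr(1)]] that by simp
    then show ?thesis using minus_in[of "\<bar>r\<bar> *\<^sub>R x"] by (cases "r \<ge> 0") auto
  qed
  show "\<bar>a * b' - b * a'\<bar> \<le> 1"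
    if "(a, b) \<in> {(a, b). a *\<^sub>R x + b *\<^sub>R y \<in> \<Omega>}" "(a', b') \<in> {(a, b). a *\<^sub>R x + b *\<^sub>R y \<in> \<Omega>}" for a b a' b'
  proof -
    have "cross2 (a *\<^sub>R x + b *\<^sub>R y) (a' *\<^sub>R x + b' *\<^sub>R y) = (a * b' - b * a') * cross2 x y"
      by (simp add: cross2_add cross2_skew[of y x] algebra_simps)
    moreover have "\<bar>cross2 (a *\<^sub>R x + b *\<^sub>R y) (a' *\<^sub>R x + b' *\<^sub>R y)\<bar> \<le> cross2 x y"
      using that closure_subset[of \<Omega>] by (intro bnd) auto
    ultimately show ?thesis using c0 by (simp add: abs_mult)
  qed
  show "\<bar>a\<bar> \<le> 1 \<and> \<bar>b\<bar> \<le> 1" if "(a, b) \<in> {(a, b). a *\<^sub>R x + b *\<^sub>R y \<in> \<Omega>}" for a b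
  proof -
    have z: "a *\<^sub>R x + b *\<^sub>R y \<in> closure \<Omega>" using that closure_subset[of \<Omega>] by auto
    have "cross2 (a *\<^sub>R x + b *\<^sub>R y) y = a * cross2 x y" "cross2 x (a *\<^sub>R x + b *\<^sub>R y) = b * cross2 x y"
      by (simp_all add: cross2_add)
    then show ?thesis
      using bnd[OF z frontier_subset_closure[OF fr(2)]] bnd[OF frontier_subset_closure[OF fr(1)] z] c0
      by (simp add: abs_mult)
  qed
qed

lemma area_le:
  assumes xy: "conjugate x y"
  shows "measure lebesgue \<Omega> \<le> pi * cross2 x y"
    and "measure lebesgue \<Omega> = pi * cross2 x y \<Longrightarrow> is_ellipse \<Omega>"
proof -
  let ?K = "{(a, b). a *\<^sub>R x + b *\<^sub>R y \<in> \<Omega>}"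
  interpret K: area_form_bounded_body ?K by (rule conjugate_coordinates_body[OF xy])
  have c0: "cross2 x y > 0" using conj_pos[OF xy] .
  have m: "measure lebesgue \<Omega> = cross2 x y * measure lborel ?K"
    using measure_oblique_coordinates[OF opn bdd, of x y] c0 by simp
  have fin: "emeasure lborel ?K = ennreal (measure lborel ?K)"
    using K.area_le_pi by (intro emeasure_eq_ennreal_measure) (auto simp: top_unique)
  then have "measure lborel ?K \<le> pi" using K.area_le_pi by (simp add: ennreal_le_iff)
  then show "measure lebesgue \<Omega> \<le> pi * cross2 x y" using m c0 by (simp add: mult.commute)
  assume "measure lebesgue \<Omega> = pi * cross2 x y"
  then have "measure lborel ?K = pi" using m c0 by simp
  then have "?K = {(a, b). a\<^sup>2 + b\<^sup>2 < 1}" using K.eq_disk_if_area_eq_pi fin by simp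
  then have "a *\<^sub>R x + b *\<^sub>R y \<in> \<Omega> \<longleftrightarrow> a\<^sup>2 + b\<^sup>2 < 1" for a b
    by (auto simp: set_eq_iff)
  then show "is_ellipse \<Omega>"
    by (rule is_ellipse_if_conjugate_diameters[rotated]) (use c0 in simp)
qed

text \<open>A symmetric ellipse is centred at the origin and is the image of the unit disk under a linear
  map of determinant \<open>\<plusminus>a b\<close>. The area form is then bounded by \<open>a b\<close>, while the area is \<open>\<pi> a b\<close>.\<close>
lemma area_ge_if_ellipse:
  assumes xy: "conjugate x y" and "is_ellipse \<Omega>"
  shows "measure lebesgue \<Omega> \<ge> pi * cross2 x y"
proof -
  obtain w u v a b where uv: "norm u = 1" "norm v = 1" "u \<bullet> v = 0" and ab: "a > 0" "b > 0"
    and \<Omega>: "\<Omega> = {x. (((x - w) \<bullet> u) / a)\<^sup>2 + (((x - w) \<bullet> v) / b)\<^sup>2 < 1}"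
    using assms(2) unfolding is_ellipse_def by blast
  have uu: "u \<bullet> u = 1" "v \<bullet> v = 1" "v \<bullet> u = 0" using uv by (auto simp: norm_eq_1 inner_commute)
  \<comment> \<open>A symmetric open interval of length 2 that is shifted by \<open>t\<close> and stays inside \<open>(-1, 1)\<close> is not
    shifted at all. This will be applied to the two axes of the ellipse.\<close>
  have zero: "t = 0" if "\<And>r. \<bar>r\<bar> < 1 \<Longrightarrow> \<bar>t + r\<bar> < 1" for t :: real
    using that[of 0] that[of "1 - t"] that[of "- 1 - t"] by linarith
  have "2 * (w \<bullet> u) / a = 0"
  proof (rule zero)
    fix r :: real assume r: "\<bar>r\<bar> < 1"
    have "w + (r * a) *\<^sub>R u \<in> \<Omega>" using r ab uu uv by (simp add: \<Omega> abs_square_less_1)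
    then have "- (w + (r * a) *\<^sub>R u) \<in> \<Omega>" by (rule minus_in)
    then have "((- (w + (r * a) *\<^sub>R u) - w) \<bullet> u / a)\<^sup>2 < 1"
      using zero_le_power2[of "(- (w + (r * a) *\<^sub>R u) - w) \<bullet> v / b"]
      unfolding \<Omega> mem_Collect_eq by linarith
    moreover have e: "(- (w + (r * a) *\<^sub>R u) - w) \<bullet> u = - (2 * (w \<bullet> u) + r * a)"
      by (simp only: inner_diff_left inner_add_left inner_minus_left inner_scaleR_left uu)
    have "(- (w + (r * a) *\<^sub>R u) - w) \<bullet> u / a = - (2 * (w \<bullet> u) / a + r)"
      unfolding e using ab by (simp add: field_simps)
    ultimately show "\<bar>2 * (w \<bullet> u) / a + r\<bar> < 1" by (simp only: power2_minus abs_square_less_1)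
  qed
  moreover have "2 * (w \<bullet> v) / b = 0"
  proof (rule zero)
    fix r :: real assume r: "\<bar>r\<bar> < 1"
    have "w + (r * b) *\<^sub>R v \<in> \<Omega>" using r ab uu uv by (simp add: \<Omega> abs_square_less_1)
    then have "- (w + (r * b) *\<^sub>R v) \<in> \<Omega>" by (rule minus_in)
    then have "((- (w + (r * b) *\<^sub>R v) - w) \<bullet> v / b)\<^sup>2 < 1"
      using zero_le_power2[of "(- (w + (r * b) *\<^sub>R v) - w) \<bullet> u / a"]
      unfolding \<Omega> mem_Collect_eq by linarith
    moreover have e: "(- (w + (r * b) *\<^sub>R v) - w) \<bullet> v = - (2 * (w \<bullet> v) + r * b)"
      by (simp only: inner_diff_left inner_add_left inner_minus_left inner_scaleR_left uu)
    have "(- (w + (r * b) *\<^sub>R v) - w) \<bullet> v / b = - (2 * (w \<bullet> v) / b + r)"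
      unfolding e using ab by (simp add: field_simps)
    ultimately show "\<bar>2 * (w \<bullet> v) / b + r\<bar> < 1" by (simp only: power2_minus abs_square_less_1)
  qed
  ultimately have "w \<bullet> u = 0" "w \<bullet> v = 0" using ab by auto
  then have "w = 0" by (subst orthonormal_expansion(1)[OF uv, of w]) simp
  then have \<Omega>0: "\<Omega> = {x. (x \<bullet> u / a)\<^sup>2 + (x \<bullet> v / b)\<^sup>2 < 1}" using \<Omega> by simp
  define c where "c = cross2 (a *\<^sub>R u) (b *\<^sub>R v)"
  have c: "\<bar>c\<bar> = a * b" using orthonormal_expansion(2)[OF uv] ab by (simp add: c_def abs_mult)
  then have "c \<noteq> 0" using ab by auto
  have "{(p, q). p *\<^sub>R (a *\<^sub>R u) + q *\<^sub>R (b *\<^sub>R v) \<in> \<Omega>} = {(p, q). p\<^sup>2 + q\<^sup>2 < 1}"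
    using ab uu uv by (auto simp: \<Omega>0 inner_add_left)
  then have area: "measure lebesgue \<Omega> = a * b * pi"
    using measure_oblique_coordinates[OF opn bdd, of "a *\<^sub>R u" "b *\<^sub>R v", folded c_def, OF \<open>c \<noteq> 0\<close>]
    by (simp only: c measure_unit_disk_prod)
  have cl: "closure \<Omega> \<subseteq> {x. (x \<bullet> u / a)\<^sup>2 + (x \<bullet> v / b)\<^sup>2 \<le> 1}"
    unfolding \<Omega>0 using ab
    by (intro closure_minimal closed_Collect_le) (auto intro!: continuous_intros)
  define p q where "p z = z \<bullet> u / a" and "q z = z \<bullet> v / b" for z
  have pq: "(p z)\<^sup>2 + (q z)\<^sup>2 \<le> 1" if "z \<in> closure \<Omega>" for z
    using cl that by (auto simp: p_def q_def)
  have z: "z = p z *\<^sub>R (a *\<^sub>R u) + q z *\<^sub>R (b *\<^sub>R v)" for z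
    by (subst orthonormal_expansion(1)[OF uv]) (use ab in \<open>simp add: p_def q_def\<close>)
  have "cross2 x y = (p x * q y - q x * p y) * c"
    by (subst z[of x], subst z[of y])
      (simp add: c_def cross2_add cross2_skew[of v u] algebra_simps)
  moreover have "\<bar>p x * q y - q x * p y\<bar> \<le> 1"
  proof -
    have "(p x * q y - q x * p y)\<^sup>2 + (p x * p y + q x * q y)\<^sup>2
        = ((p x)\<^sup>2 + (q x)\<^sup>2) * ((p y)\<^sup>2 + (q y)\<^sup>2)"
      by (simp add: power2_eq_square algebra_simps)
    also have "\<dots> \<le> 1 * 1"
      using conj_frontier[OF xy] frontier_subset_closure pq by (intro mult_mono) auto
    finally have "(p x * q y - q x * p y)\<^sup>2 \<le> 1"
      using zero_le_power2[of "p x * p y + q x * q y"] by linarith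
    then show ?thesis by (simp add: abs_square_le_1)
  qed
  ultimately have "\<bar>cross2 x y\<bar> \<le> 1 * \<bar>c\<bar>"
    using mult_right_mono[of "\<bar>p x * q y - q x * p y\<bar>" 1 "\<bar>c\<bar>"] by (simp add: abs_mult)
  then have "cross2 x y \<le> a * b" using c by linarith
  then show ?thesis unfolding area by (simp add: mult.commute)
qed

end

theorem theorem5p4:
  fixes \<Omega> :: "(real ^ 2) set"
  assumes "C2_convex_domain \<Omega>"
    and "radon_boundary \<Omega>"
  shows "beta_out \<Omega> (1/4) \<ge> measure lebesgue \<Omega> / pi * beta_out (ball 0 1) (1/4) \<and>
    (beta_out \<Omega> (1/4) = measure lebesgue \<Omega> / pi * beta_out (ball 0 1) (1/4) \<longleftrightarrow> is_ellipse \<Omega>)"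
proof -
  interpret radon_domain \<Omega> using assms by unfold_locales
  obtain x where "x \<in> frontier \<Omega>"
    using normalize_to_frontier[of "axis 1 1"] by (auto simp: axis_eq_0_iff)
  then obtain y where xy: "conjugate x y" using ex_conj by blast
  have beta: "beta_out \<Omega> (1/4) = cross2 x y" by (rule beta_out_quarter[OF xy])
  have "is_ellipse \<Omega> \<longleftrightarrow> measure lebesgue \<Omega> = pi * cross2 x y"
    using area_le[OF xy] area_ge_if_ellipse[OF xy] by linarith
  moreover have "cross2 x y = measure lebesgue \<Omega> / pi \<longleftrightarrow> measure lebesgue \<Omega> = pi * cross2 x y"
    by (auto simp: field_simps)
  moreover have "cross2 x y \<ge> measure lebesgue \<Omega> / pi"
    using area_le(1)[OF xy] by (simp add: divide_le_eq mult.commute)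
  ultimately show ?thesis by (simp add: beta beta_out_unit_ball)
qed

end
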